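(* Let $W_7=\{(0,0,0),(1,1,1)\}$, $W_8=\{(0,0,1),(0,1,0),(1,0,0)\}$, $W_9=\{(0,0,0),(0,0,1),(0,1,0),(1,1,1)\}$, $W_{10}=\{(0,0,0),(0,0,1),(1,1,1)\}$ and $W_{12}=\{(0,0,0),(0,0,1),(0,1,0),(1,0,0)\}$, all subsets of $\{0,1\}^3$. Then the inducibility constants satisfy $\lambda(W_7)=1/3$, $\lambda(W_8)=2/3$, $\lambda(W_9)=4/9$, $\lambda(W_{10})=5/12$ and $\lambda(W_{12})=1/2$.
   Context: The $n$-hypercube $Q_n$ is the graph on $\{0,1\}^n$ in which two sequences are adjacent iff they differ in exactly one coordinate. A $d$-subcube of $\{0,1\}^n$ is a set $C\subseteq\{0,1\}^n$ obtained by fixing $n-d$ coordinates to constant values and letting the remaining $d$ coordinates vary arbitrarily; there are $\binom nd 2^{n-d}$ of them (equivalently, $C$ is a set whose induced subgraph $Q_n[C]$ is isomorphic to $Q_d$). For $H\subseteq\{0,1\}^d$ and $S\subseteq\{0,1\}^n$, a $d$-subcube $C$ gives a copy of $H$ in $S$ if there is a graph isomorphism $f$ from $Q_d$ to $Q_n[C]$ with $f(H)=S\cap C$. Let $\Lambda(H,S)$ be the number of $d$-subcubes giving a copy of $H$ in $S$, let $\Lambda(H,n)=\max\{\Lambda(H,S): S\subseteq\{0,1\}^n\}$ for $n\ge d$, and let the inducibility constant be $\lambda(H)=\lim_{n\to\infty}\Lambda(H,n)/\big(\binom nd 2^{n-d}\big)$ (the limit exists since the ratio is non-increasing in $n$).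 *)

theory Defs
  imports Complex_Main
begin

text \<open>Vertices of the n-hypercube: 0/1 sequences of length n, encoded as bool lists
  (False = 0, True = 1).\<close>
definition cube :: "nat \<Rightarrow> bool list set" where
  "cube n = {xs. length xs = n}"

definition adj :: "bool list \<Rightarrow> bool list \<Rightarrow> bool" where
  "adj x y \<longleftrightarrow> length x = length y \<and> card {i. i < length x \<and> x ! i \<noteq> y ! i} = 1"

definition subcube :: "nat \<Rightarrow> nat \<Rightarrow> bool list set \<Rightarrow> bool" where
  "subcube n d C \<longleftrightarrow> (\<exists>D a. D \<subseteq> {..<n} \<and> card D = d \<and> a \<in> cube n \<and>
      C = {x \<in> cube n. \<forall>i<n. i \<notin> D \<longrightarrow> x ! i = a ! i})"

definition gives_copy :: "nat \<Rightarrow> bool list set \<Rightarrow> bool list set \<Rightarrow> bool list set \<Rightarrow> bool" where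
  "gives_copy d H S C \<longleftrightarrow> (\<exists>f. bij_betw f (cube d) C \<and>
      (\<forall>x\<in>cube d. \<forall>y\<in>cube d. adj x y \<longleftrightarrow> adj (f x) (f y)) \<and>
      f ` H = S \<inter> C)"

definition Lambda_set :: "nat \<Rightarrow> bool list set \<Rightarrow> nat \<Rightarrow> bool list set \<Rightarrow> nat" where
  "Lambda_set d H n S = card {C. subcube n d C \<and> gives_copy d H S C}"

definition Lambda_max :: "nat \<Rightarrow> bool list set \<Rightarrow> nat \<Rightarrow> nat" where
  "Lambda_max d H n = Max {Lambda_set d H n S | S. S \<subseteq> cube n}"

text \<open>The normalised ratio \<Lambda>(H,n) / (binom(n,d) 2^(n-d)); the inducibility constant
  \<lambda>(H) is its limit as n \<rightarrow> \<infinity>.\<close>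
definition ind_ratio :: "nat \<Rightarrow> bool list set \<Rightarrow> nat \<Rightarrow> real" where
  "ind_ratio d H n = real (Lambda_max d H n) / (real (n choose d) * 2 ^ (n - d))"

definition W7 :: "bool list set" where
  "W7 = {[False,False,False], [True,True,True]}"
definition W8 :: "bool list set" where
  "W8 = {[False,False,True], [False,True,False], [True,False,False]}"
definition W9 :: "bool list set" where
  "W9 = {[False,False,False], [False,False,True], [False,True,False], [True,True,True]}"
definition W10 :: "bool list set" where
  "W10 = {[False,False,False], [False,False,True], [True,True,True]}"
definition W12 :: "bool list set" where
  "W12 = {[False,False,False], [False,False,True], [False,True,False], [True,False,False]}"

end

theory Submission
  imports Defs "HOL-Real_Asymp.Real_Asymp"
begin

text \<open>
  Upper bounds. For a vertex v and directions i, j, k, l, possibly equal, restrict S to the 4-cube they span.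
  Summed over all choices, the square of a sum of g(v, i, k) over k turns into a sum of products over pairs of directions,
  hence into a sum of a function of the restricted colouring. After averaging that function over the symmetries of the
  cube, the bound for the density of H becomes a pointwise inequality between functions of a colouring of a 3-cube
  (for W8: of a 4-cube). For W7 and W12 one square suffices, W9 and W10 need five and six. For W8 the square compares,
  for each 2-face with two antipodal points of S, the extensions to a copy of W8 centred at either of the other
  two corners. Allowing equal directions makes all these identities exact, and only costs a factor tending to 1.

  Lower bounds. Colour v by an element of a finite abelian group that each coordinate of v shifts by a fixed weight, and
  average over all translates of the colouring; whether a subcube is a copy then depends on the three weights only.
  The colourings are the weight modulo 3 for W7 and W8, modulo 4 for W12, and modulo 4 with a third of the coordinates
  counted twice for W9. For W10 the group is the quotient of the 6-cube by its antipodal map.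
\<close>

section \<open>Subcubes of dimension three\<close>

text \<open>A square is useful only if it vanishes, to leading order, on the extremal colouring.
  Every type of subcube that has positive density there must turn the pointwise inequality into an
  equality, and this is what fixes the weight of a square relative to the indicator of a copy.

  The lower densities are a share of roots times a share of direction triples. With all weights
  equal these are 1 of 3 roots for W7, 2 of 3 for W8 and 2 of 4 for W12. For W9 every root works as
  soon as exactly one of the three directions counts twice, and 3p(1-p)^2 is largest at p = 1/3,
  with value 4/9. For W10 the three directions are taken from different ones of six classes, a share
  6*5*4/6^3 = 5/9, and 24 of 32 roots work: 5/9 * 3/4 = 5/12.

  A square over an edge produces products on 3-cubes, whose 256 colourings can be checked one by
  one. The square for W8 sits on a 2-face and produces products on 4-cubes with 2^16 colourings;
  enumeration is replaced there by counting the facets that are copies.\<close>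

type_synonym pattern3 = "bool \<Rightarrow> bool \<Rightarrow> bool \<Rightarrow> bool"
type_synonym pattern4 = "bool \<Rightarrow> bool \<Rightarrow> bool \<Rightarrow> bool \<Rightarrow> bool"

section \<open>Coordinate flips and faces of the cube\<close>

definition flip :: "nat \<Rightarrow> bool list \<Rightarrow> bool list" where
  "flip i v = v[i := \<not> v ! i]"

definition flip_if :: "bool \<Rightarrow> nat \<Rightarrow> bool list \<Rightarrow> bool list" where
  "flip_if b i v = (if b then flip i v else v)"

definition face :: "nat \<Rightarrow> nat set \<Rightarrow> bool list \<Rightarrow> bool list set" where
  "face n D a = {x \<in> cube n. \<forall>i<n. i \<notin> D \<longrightarrow> x ! i = a ! i}"

definition pattern :: "bool list set \<Rightarrow> bool list \<Rightarrow> nat \<Rightarrow> nat \<Rightarrow> nat \<Rightarrow> pattern3" where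
  "pattern S v i j k x y z \<longleftrightarrow> flip_if x i (flip_if y j (flip_if z k v)) \<in> S"

definition triples :: "nat \<Rightarrow> (bool list \<times> nat \<times> nat \<times> nat) set" where
  "triples n = {(v, i, j, k). v \<in> cube n \<and> i < n \<and> j < n \<and> k < n \<and> distinct [i, j, k]}"

lemma flip_if_simps [simp]: "flip_if False i v = v" "flip_if True i v = flip i v"
  by (simp_all add: flip_if_def)

lemma length_flip [simp]: "length (flip i v) = length v"
  by (simp add: flip_def)

lemma length_flip_if [simp]: "length (flip_if b i v) = length v"
  by (simp add: flip_if_def)

lemma nth_flip: "m < length v \<Longrightarrow> flip i v ! m = (v ! m \<noteq> (m = i))"
  by (auto simp: flip_def nth_list_update)

lemma nth_flip_if: "m < length v \<Longrightarrow> flip_if b i v ! m = (v ! m \<noteq> (b \<and> m = i))"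
  by (simp add: flip_if_def nth_flip)

lemma flip_flip [simp]: "flip i (flip i v) = v"
  by (rule nth_equalityI) (auto simp: nth_flip)

lemma flip_commute: "flip i (flip j v) = flip j (flip i v)"
  by (rule nth_equalityI) (auto simp: nth_flip)

lemma flip_if_commute: "flip_if a i (flip_if b j v) = flip_if b j (flip_if a i v)"
  by (rule nth_equalityI) (auto simp: nth_flip_if)

lemma flip_in_cube [simp]: "flip i v \<in> cube n \<longleftrightarrow> v \<in> cube n"
  by (simp add: cube_def)

lemma flip_if_in_cube [simp]: "flip_if b i v \<in> cube n \<longleftrightarrow> v \<in> cube n"
  by (simp add: cube_def)

lemma finite_cube [simp]: "finite (cube n)"
  using finite_lists_length_eq[of "UNIV :: bool set" n] by (simp add: cube_def)

lemma card_cube: "card (cube n) = 2 ^ n"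
  using card_lists_length_eq[of "UNIV :: bool set" n] by (simp add: cube_def)

lemma adj_iff_flip: "adj x y \<longleftrightarrow> (\<exists>i<length x. y = flip i x)"
proof
  assume "adj x y"
  then have l: "length x = length y" and "card {i. i < length x \<and> x ! i \<noteq> y ! i} = 1"
    by (auto simp: adj_def)
  then obtain i where i: "{i. i < length x \<and> x ! i \<noteq> y ! i} = {i}"
    by (auto simp: card_1_singleton_iff)
  then have "y = flip i x"
    using l by (intro nth_equalityI) (auto simp: nth_flip set_eq_iff)
  then show "\<exists>i<length x. y = flip i x" using i by blast
next
  assume "\<exists>i<length x. y = flip i x"
  then obtain i where "i < length x" "y = flip i x" by blast
  then have "{m. m < length x \<and> x ! m \<noteq> y ! m} = {i}" by (auto simp: nth_flip)
  then show "adj x y" using \<open>y = flip i x\<close> by (simp add: adj_def)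
qed

text \<open>Two vertices at distance two have exactly two common neighbours, so the one different
  from \<open>v\<close> is forced. Cube isomorphisms are reconstructed from this.\<close>

lemma common_neighbour:
  assumes "flip m (flip i v) = flip l (flip j v)" "i \<noteq> j"
    and "i < length v" "j < length v" "m < length v" "l < length v"
    and "flip m (flip i v) \<noteq> v"
  shows "flip m (flip i v) = flip i (flip j v)"
proof -
  have "m \<noteq> i" using assms(7) by auto
  moreover have "(flip m (flip i v) ! i) = (flip l (flip j v) ! i)" using assms(1) by simp
  ultimately have "l = i" using assms(2-6) by (auto simp: nth_flip)
  then show ?thesis using assms(1) by simp
qed

lemma subcube_iff_face:
  "subcube n d C \<longleftrightarrow> (\<exists>D a. D \<subseteq> {..<n} \<and> card D = d \<and> a \<in> cube n \<and> C = face n D a)"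
  by (simp add: subcube_def face_def)

lemma face_self: "a \<in> cube n \<Longrightarrow> a \<in> face n D a"
  by (simp add: face_def)

text \<open>The set \<open>D\<close> is recovered from the face as the set of coordinates that can
  be flipped without leaving it.\<close>

lemma face_eq_iff:
  assumes "D \<subseteq> {..<n}" "D' \<subseteq> {..<n}" "a \<in> cube n" "a' \<in> cube n"
  shows "face n D a = face n D' a' \<longleftrightarrow> D = D' \<and> a' \<in> face n D a"
proof
  assume eq: "face n D a = face n D' a'"
  have sub: "E \<subseteq> E'"
    if "E \<subseteq> {..<n}" "b \<in> cube n" "b' \<in> cube n" "face n E b = face n E' b'" for E E' b b'
  proof
    fix i assume i: "i \<in> E"
    then have "flip i b \<in> face n E b" "b \<in> face n E b" "i < n"
      using that(1,2) by (auto simp: face_def cube_def nth_flip)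
    then have "flip i b \<in> face n E' b'" "b \<in> face n E' b'" unfolding that(4) by simp_all
    then have "flip i b ! i = b ! i" if "i \<notin> E'"
      using \<open>i < n\<close> that by (auto simp: face_def)
    then show "i \<in> E'" using \<open>i < n\<close> that(2) by (auto simp: cube_def nth_flip)
  qed
  show "D = D' \<and> a' \<in> face n D a"
    using sub[OF assms(1,3,4) eq] sub[OF assms(2,4,3) eq[symmetric]] face_self[OF assms(4), of D'] eq
    by auto
next
  assume "D = D' \<and> a' \<in> face n D a"
  then show "face n D a = face n D' a'" by (auto simp: face_def)
qed

lemma face_three:
  assumes "v \<in> cube n" "i < n" "j < n" "k < n"
  shows "face n {i, j, k} v = (\<lambda>(x, y, z). flip_if x i (flip_if y j (flip_if z k v))) ` UNIV"
proof (intro equalityI subsetI)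
  fix w assume w: "w \<in> face n {i, j, k} v"
  \<comment> \<open>The directions may coincide here, so a repeated one is flipped only at its first
    occurrence.\<close>
  have "\<exists>x y z. w = flip_if x i (flip_if y j (flip_if z k v))"
    apply (rule exI[of _ "w ! i \<noteq> v ! i"])
    apply (rule exI[of _ "j \<noteq> i \<and> w ! j \<noteq> v ! j"])
    apply (rule exI[of _ "k \<noteq> i \<and> k \<noteq> j \<and> w ! k \<noteq> v ! k"])
    using w assms by (intro nth_equalityI) (auto simp: face_def cube_def nth_flip_if)
  then obtain x y z where "w = flip_if x i (flip_if y j (flip_if z k v))" by blast
  then show "w \<in> (\<lambda>(x, y, z). flip_if x i (flip_if y j (flip_if z k v))) ` UNIV"
    by (intro image_eqI[of _ _ "(x, y, z)"]) auto
next
  fix w assume "w \<in> (\<lambda>(x, y, z). flip_if x i (flip_if y j (flip_if z k v))) ` UNIV"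
  then show "w \<in> face n {i, j, k} v"
    using assms by (auto simp: face_def cube_def nth_flip_if)
qed

lemma inj_flips:
  assumes "i < length v" "j < length v" "k < length v" "distinct [i, j, k]"
  shows "inj (\<lambda>(x, y, z). flip_if x i (flip_if y j (flip_if z k v)))"
proof (rule injI)
  fix t t' :: "bool \<times> bool \<times> bool"
  obtain x y z x' y' z' where t: "t = (x, y, z)" "t' = (x', y', z')"
    by (cases t, cases t')
  assume "(\<lambda>(x, y, z). flip_if x i (flip_if y j (flip_if z k v))) t =
    (\<lambda>(x, y, z). flip_if x i (flip_if y j (flip_if z k v))) t'"
  then have "flip_if x i (flip_if y j (flip_if z k v)) ! m = flip_if x' i (flip_if y' j (flip_if z' k v)) ! m" for m
    by (simp add: t)
  from this[of i] this[of j] this[of k] have "x = x'" "y = y'" "z = z'"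
    using assms by (simp_all add: nth_flip_if) blast+
  then show "t = t'" by (simp add: t)
qed

lemma card_face_three:
  assumes "v \<in> cube n" "i < n" "j < n" "k < n" "distinct [i, j, k]"
  shows "card (face n {i, j, k} v) = 8"
proof -
  have "card (UNIV :: (bool \<times> bool \<times> bool) set) = 8"
    by (simp add: card_cartesian_product flip: UNIV_Times_UNIV)
  then show ?thesis
    unfolding face_three[OF assms(1-4)]
    using assms by (subst card_image[OF inj_flips]) (auto simp: cube_def)
qed

lemma card_orderings_three:
  assumes "distinct [i, j, k]"
  shows "card {(i', j', k'). {i', j', k'} = {i, j, k} \<and> distinct [i', j', k']} = 6"
proof -
  have "{(i', j', k'). {i', j', k'} = {i, j, k} \<and> distinct [i', j', k']} =
      {(i, j, k), (i, k, j), (j, i, k), (j, k, i), (k, i, j), (k, j, i)}"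
    (is "?L = ?R")
  proof (intro equalityI subsetI)
    fix t assume "t \<in> ?L"
    then obtain i' j' k' where t: "t = (i', j', k')" "{i', j', k'} = {i, j, k}" "distinct [i', j', k']"
      by auto
    then have "i' \<in> {i, j, k}" "j' \<in> {i, j, k}" "k' \<in> {i, j, k}" by blast+
    then show "t \<in> ?R" using t(1,3) by (elim insertE; simp)
  qed (use assms in auto)
  then show ?thesis using assms by simp
qed

section \<open>Counting copies by a root and an ordered triple of directions\<close>

lemma finite_triples: "finite (triples n)"
  by (rule finite_subset[of _ "cube n \<times> {..<n} \<times> {..<n} \<times> {..<n}"]) (auto simp: triples_def)

text \<open>A 3-subcube has 8 roots and 6 orderings of its directions, hence the factor 48.\<close>

lemma card_copies:
  "card {(v, i, j, k) \<in> triples n. gives_copy 3 H S (face n {i, j, k} v)} = 48 * Lambda_set 3 H n S"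
proof -
  define P where "P = {(v, i, j, k) \<in> triples n. gives_copy 3 H S (face n {i, j, k} v)}"
  define G where "G = {C. subcube n 3 C \<and> gives_copy 3 H S C}"
  define fib where "fib C = {(v, i, j, k) \<in> triples n. face n {i, j, k} v = C}" for C
  have fin_fib: "finite (fib C)" for C
    unfolding fib_def by (rule finite_subset[OF _ finite_triples[of n]]) auto
  have sub: "subcube n 3 (face n {i, j, k} v)" if "(v, i, j, k) \<in> triples n" for v i j k
    unfolding subcube_iff_face using that
    by (intro exI[of _ "{i, j, k}"] exI[of _ v]) (auto simp: triples_def)
  have P_eq: "P = (\<Union>C\<in>G. fib C)" unfolding P_def G_def fib_def using sub by auto
  moreover have "finite G"
  proof (rule finite_subset)
    show "G \<subseteq> Pow (cube n)" by (auto simp: G_def subcube_def)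
  qed simp
  moreover have "card (fib C) = 48" if C: "C \<in> G" for C
  proof -
    obtain D a where D: "D \<subseteq> {..<n}" "card D = 3" "a \<in> cube n" "C = face n D a"
      using C unfolding G_def subcube_iff_face by blast
    then obtain i j k where ijk: "D = {i, j, k}" "distinct [i, j, k]"
      by (auto simp: card_3_iff)
    have "fib C = C \<times> {(i', j', k'). {i', j', k'} = {i, j, k} \<and> distinct [i', j', k']}"
    proof (intro equalityI subsetI)
      fix t assume "t \<in> fib C"
      then obtain v i' j' k' where t: "t = (v, i', j', k')" "(v, i', j', k') \<in> triples n"
          "face n {i, j, k} a = face n {i', j', k'} v"
        unfolding fib_def D(4) ijk(1) by (auto simp del: insert_iff)
      from t(2) have lt: "{i', j', k'} \<subseteq> {..<n}" "v \<in> cube n" "distinct [i', j', k']"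
        unfolding triples_def by simp_all
      have "{i, j, k} = {i', j', k'} \<and> v \<in> face n {i, j, k} a"
        using face_eq_iff[OF _ lt(1) D(3) lt(2), of "{i, j, k}"] D(1) t(3) unfolding ijk(1) by blast
      then show "t \<in> C \<times> {(i', j', k'). {i', j', k'} = {i, j, k} \<and> distinct [i', j', k']}"
        using t(1) lt(3) unfolding D(4) ijk(1) by (metis (mono_tags, lifting) SigmaI case_prodI mem_Collect_eq)
    next
      fix t assume "t \<in> C \<times> {(i', j', k'). {i', j', k'} = {i, j, k} \<and> distinct [i', j', k']}"
      then obtain v i' j' k' where t: "t = (v, i', j', k')" "v \<in> C" "{i', j', k'} = {i, j, k}"
          "distinct [i', j', k']"
        by blast
      have v: "v \<in> cube n" using t(2) by (simp add: D(4) face_def)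
      have lt: "{i', j', k'} \<subseteq> {..<n}" using t(3) D(1) ijk(1) by simp
      have "face n D a = face n {i', j', k'} v"
        using face_eq_iff[OF D(1) lt D(3) v] t(2,3) unfolding D(4) ijk(1) by blast
      then show "t \<in> fib C"
        using t(1,4) v lt unfolding fib_def triples_def D(4) by simp
    qed
    then show ?thesis
      using card_face_three[of a n i j k] card_orderings_three[OF ijk(2)] D ijk
      by (simp add: card_cartesian_product)
  qed
  moreover have "fib C \<inter> fib C' = {}" if "C \<noteq> C'" for C C'
    using that by (auto simp: fib_def)
  ultimately have "card P = (\<Sum>C\<in>G. 48)"
    by (subst P_eq, subst card_UN_disjoint) (auto simp: fin_fib)
  then show ?thesis by (simp add: P_def G_def Lambda_set_def)
qed

section \<open>Copies as a condition on a colouring of the standard 3-cube\<close>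

lemma pattern_face:
  assumes "v \<in> cube n" "i < n" "j < n" "k < n" "w \<in> face n {i, j, k} v"
  shows "\<exists>a b c. pattern S w i j k = (\<lambda>x y z. pattern S v i j k (x \<noteq> a) (y \<noteq> b) (z \<noteq> c))"
proof -
  obtain a b c where w: "w = flip_if a i (flip_if b j (flip_if c k v))"
    using assms(5) unfolding face_three[OF assms(1-4)] by auto
  have "flip_if x i (flip_if y j (flip_if z k w)) =
      flip_if (x \<noteq> a) i (flip_if (y \<noteq> b) j (flip_if (z \<noteq> c) k v))" for x y z
    unfolding w by (rule nth_equalityI) (auto simp: nth_flip_if)
  then show ?thesis by (intro exI[of _ a] exI[of _ b] exI[of _ c]) (simp add: fun_eq_iff pattern_def)
qed

lemma cube_3_eq: "cube 3 = (\<lambda>(x, y, z). [x, y, z]) ` UNIV"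
proof (intro equalityI subsetI)
  fix w assume "w \<in> cube 3"
  then obtain x y z where "w = [x, y, z]"
    by (auto simp: cube_def numeral_3_eq_3 length_Suc_conv)
  then show "w \<in> (\<lambda>(x, y, z). [x, y, z]) ` UNIV" by (intro image_eqI[of _ _ "(x, y, z)"]) auto
qed (auto simp: cube_def)

lemma in_cube_3 [simp]: "[x, y, z] \<in> cube 3"
  by (simp add: cube_def)

lemma flip_list3 [simp]:
  "flip 0 [x, y, z] = [\<not> x, y, z]" "flip (Suc 0) [x, y, z] = [x, \<not> y, z]"
  "flip 2 [x, y, z] = [x, y, \<not> z]"
  by (simp_all add: flip_def numeral_2_eq_2)

lemma adj_list3 [simp]:
  "adj [x, y, z] [\<not> x, y, z]" "adj [x, y, z] [x, \<not> y, z]" "adj [x, y, z] [x, y, \<not> z]"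
  unfolding adj_iff_flip
  by (rule exI[of _ 0], simp, rule exI[of _ "Suc 0"], simp, rule exI[of _ 2], simp)

lemma gives_copyI:
  assumes v: "v \<in> cube n" and lt: "i < n" "j < n" "k < n" and dist: "distinct [i, j, k]"
    and H: "H \<subseteq> cube 3"
    and pat: "\<And>x y z. pattern S v i j k x y z \<longleftrightarrow> [x, y, z] \<in> H"
  shows "gives_copy 3 H S (face n {i, j, k} v)"
proof -
  define F where "F = (\<lambda>(x, y, z). flip_if x i (flip_if y j (flip_if z k v)))"
  define f where "f w = F (w ! 0, w ! 1, w ! 2)" for w
  have len: "length v = n" using v by (simp add: cube_def)
  have f3: "f [x, y, z] = F (x, y, z)" for x y z by (simp add: f_def)
  have injF: "inj F" unfolding F_def by (rule inj_flips) (use lt dist len in auto)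
  have face: "face n {i, j, k} v = range F" unfolding F_def by (rule face_three[OF v lt])
  have img: "f ` cube 3 = range F" unfolding cube_3_eq image_image
    by (rule image_cong) (auto simp: f3)
  have "inj_on f (cube 3)"
    using injF unfolding cube_3_eq by (auto simp: inj_on_def f3 dest: injD)
  then have bij: "bij_betw f (cube 3) (face n {i, j, k} v)"
    by (simp add: bij_betw_def img face)
  have adj: "adj w w' \<longleftrightarrow> adj (f w) (f w')" if w: "w \<in> cube 3" "w' \<in> cube 3" for w w'
  proof -
    obtain x y z x' y' z' where w: "w = [x, y, z]" "w' = [x', y', z']"
      using w unfolding cube_3_eq by auto
    have "{m. m < length (f w) \<and> f w ! m \<noteq> f w' ! m} =
        (\<lambda>m. [i, j, k] ! m) ` {m. m < 3 \<and> w ! m \<noteq> w' ! m}"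
    proof (intro equalityI subsetI)
      fix m assume m: "m \<in> {m. m < length (f w) \<and> f w ! m \<noteq> f w' ! m}"
      then have "m = i \<and> x \<noteq> x' \<or> m = j \<and> y \<noteq> y' \<or> m = k \<and> z \<noteq> z'"
        by (auto simp: w f3 F_def nth_flip_if simp del: flip_if_simps)
      then consider "m = i" "x \<noteq> x'" | "m = j" "y \<noteq> y'" | "m = k" "z \<noteq> z'" by blast
      then show "m \<in> (\<lambda>m. [i, j, k] ! m) ` {m. m < 3 \<and> w ! m \<noteq> w' ! m}"
      proof cases
        case 1 then show ?thesis by (intro image_eqI[of _ _ 0]) (auto simp: w)
      next
        case 2 then show ?thesis by (intro image_eqI[of _ _ 1]) (auto simp: w)
      next
        case 3 then show ?thesis by (intro image_eqI[of _ _ 2]) (auto simp: w)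
      qed
    next
      fix m assume "m \<in> (\<lambda>m. [i, j, k] ! m) ` {m. m < 3 \<and> w ! m \<noteq> w' ! m}"
      then obtain r where r: "m = [i, j, k] ! r" "r < 3" "w ! r \<noteq> w' ! r" by auto
      from r(2) have "r = 0 \<or> r = 1 \<or> r = 2" by auto
      then show "m \<in> {m. m < length (f w) \<and> f w ! m \<noteq> f w' ! m}"
        using r lt dist len by (elim disjE) (simp_all add: w f3 F_def nth_flip_if)
    qed
    moreover have "inj_on (\<lambda>m. [i, j, k] ! m) {m. m < 3 \<and> w ! m \<noteq> w' ! m}"
      by (rule inj_on_subset[OF inj_on_nth[OF dist, of "{..<3}"]]) auto
    ultimately have "card {m. m < length (f w) \<and> f w ! m \<noteq> f w' ! m} = card {m. m < 3 \<and> w ! m \<noteq> w' ! m}"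
      by (simp add: card_image)
    moreover have "length w = 3" "length w' = 3" "length (f w') = length (f w)"
      by (simp_all add: w f3 F_def)
    ultimately show ?thesis by (simp add: adj_def)
  qed
  have "f ` H = S \<inter> face n {i, j, k} v"
  proof (intro equalityI subsetI)
    fix u assume "u \<in> f ` H"
    then obtain w where w: "w \<in> H" "u = f w" by auto
    then obtain x y z where "w = [x, y, z]" using H unfolding cube_3_eq by auto
    then show "u \<in> S \<inter> face n {i, j, k} v"
      using w pat[of x y z] unfolding face by (auto simp: f3 pattern_def F_def[symmetric]) (simp add: F_def)
  next
    fix u assume u: "u \<in> S \<inter> face n {i, j, k} v"
    then obtain x y z where "u = F (x, y, z)" unfolding face by auto
    then show "u \<in> f ` H"
      using u pat[of x y z] by (intro image_eqI[of _ _ "[x, y, z]"]) (auto simp: f3 F_def pattern_def)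
  qed
  then show ?thesis unfolding gives_copy_def using bij adj by blast
qed

text \<open>An isomorphism is determined by the images of the origin and its three neighbours: each
  further vertex must go to the second common neighbour of two images already known. So it merely
  chooses a root and an ordering of the directions.\<close>

lemma gives_copyE:
  assumes v: "v \<in> cube n" and lt: "i < n" "j < n" "k < n" and dist: "distinct [i, j, k]"
    and H: "H \<subseteq> cube 3" and copy: "gives_copy 3 H S (face n {i, j, k} v)"
  obtains w i' j' k' where "w \<in> face n {i, j, k} v" "{i', j', k'} = {i, j, k}" "distinct [i', j', k']"
    "\<And>x y z. pattern S w i' j' k' x y z \<longleftrightarrow> [x, y, z] \<in> H"
proof -
  let ?C = "face n {i, j, k} v"
  obtain f where bij: "bij_betw f (cube 3) ?C"
      and adj: "\<And>x y. x \<in> cube 3 \<Longrightarrow> y \<in> cube 3 \<Longrightarrow> adj x y \<Longrightarrow> adj (f x) (f y)"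
      and img: "f ` H = S \<inter> ?C"
    using copy unfolding gives_copy_def by blast
  have inj: "f p = f q \<longleftrightarrow> p = q" if "p \<in> cube 3" "q \<in> cube 3" for p q
    using bij that by (auto simp: bij_betw_def inj_on_def)
  have inC: "f p \<in> ?C" if "p \<in> cube 3" for p using bij that by (auto simp: bij_betw_def)
  have len: "length (f p) = n" if "p \<in> cube 3" for p
    using inC[OF that] by (simp add: face_def cube_def)
  have step: "\<exists>i<n. f q = flip i (f p)" if "p \<in> cube 3" "q \<in> cube 3" "adj p q" for p q
    using adj[OF that] len[OF that(1)] by (simp add: adj_iff_flip)
  define w where "w = f [False, False, False]"
  have wlen: "length w = n" unfolding w_def by (rule len) simp
  obtain a where a: "a < n" "f [True, False, False] = flip a w"
    using step[of "[False, False, False]" "[True, False, False]"] adj_list3(1)[of False] by (auto simp: w_def)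
  obtain b where b: "b < n" "f [False, True, False] = flip b w"
    using step[of "[False, False, False]" "[False, True, False]"] adj_list3(2)[of _ False] by (auto simp: w_def)
  obtain c where c: "c < n" "f [False, False, True] = flip c w"
    using step[of "[False, False, False]" "[False, False, True]"] adj_list3(3)[of _ _ False] by (auto simp: w_def)
  have ab: "a \<noteq> b" using a b inj[of "[True, False, False]" "[False, True, False]"] by auto
  have ac: "a \<noteq> c" using a c inj[of "[True, False, False]" "[False, False, True]"] by auto
  have bc: "b \<noteq> c" using b c inj[of "[False, True, False]" "[False, False, True]"] by auto
  have corner: "f r = flip s (flip t u)"
    if prem: "p \<in> cube 3" "q \<in> cube 3" "r \<in> cube 3" "u = f o'" "o' \<in> cube 3" "adj p r" "adj q r" "r \<noteq> o'"
      "f p = flip s u" "f q = flip t u" "s < n" "t < n" "s \<noteq> t" for p q r o' s t u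
  proof -
    obtain m where m: "m < n" "f r = flip m (f p)" using step prem by blast
    obtain l where l: "l < n" "f r = flip l (f q)" using step prem by blast
    have "f r \<noteq> u" using inj prem by auto
    then show ?thesis
      using common_neighbour[of m s u l t] m l prem len[OF prem(5)] by auto
  qed
  have f110: "f [True, True, False] = flip a (flip b w)"
    by (rule corner[OF _ _ _ w_def _ _ _ _ a(2) b(2) a(1) b(1) ab])
      (use adj_list3(2)[of True False False] adj_list3(1)[of False True False] in simp_all)
  have f101: "f [True, False, True] = flip a (flip c w)"
    by (rule corner[OF _ _ _ w_def _ _ _ _ a(2) c(2) a(1) c(1) ac])
      (use adj_list3(3)[of True False False] adj_list3(1)[of False False True] in simp_all)
  have f011: "f [False, True, True] = flip b (flip c w)"
    by (rule corner[OF _ _ _ w_def _ _ _ _ b(2) c(2) b(1) c(1) bc])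
      (use adj_list3(3)[of False True False] adj_list3(2)[of False False True] in simp_all)
  \<comment> \<open>Here the known common neighbour is the image of 100, seen from the images of 110
    and 101.\<close>
  have f111: "f [True, True, True] = flip b (flip c (flip a w))"
    by (rule corner[where o' = "[True, False, False]" and p = "[True, True, False]" and q = "[True, False, True]"])
      (use adj_list3(3)[of True True False] adj_list3(2)[of True False True] a f110 f101 b c bc
        in \<open>simp_all add: flip_commute\<close>)
  have f: "f [x, y, z] = flip_if x a (flip_if y b (flip_if z c w))" for x y z
    using f110 f101 f011 f111 a b c by (cases x; cases y; cases z) (simp_all add: w_def flip_commute)
  have "pattern S w a b c x y z \<longleftrightarrow> [x, y, z] \<in> H" for x y z
  proof -
    have "pattern S w a b c x y z \<longleftrightarrow> f [x, y, z] \<in> S \<inter> ?C"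
      using inC[of "[x, y, z]"] by (simp add: pattern_def f)
    also have "\<dots> \<longleftrightarrow> [x, y, z] \<in> H"
      unfolding img[symmetric] using inj H by (auto simp: subset_iff)
    finally show ?thesis .
  qed
  moreover have wC: "w \<in> ?C" unfolding w_def by (rule inC) simp
  moreover have "{a, b, c} = {i, j, k}"
  proof -
    have "t \<in> {i, j, k}" if "t < n" "flip t w \<in> ?C" for t
      using that wC wlen by (auto simp: face_def nth_flip)
    moreover have "flip a w \<in> ?C" "flip b w \<in> ?C" "flip c w \<in> ?C"
      using a b c inC by (metis in_cube_3)+
    ultimately have "{a, b, c} \<subseteq> {i, j, k}" using a b c by blast
    moreover have "card {a, b, c} = card {i, j, k}" using ab ac bc dist by simp
    ultimately show ?thesis by (intro card_subset_eq) auto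
  qed
  ultimately show thesis using that ab ac bc by auto
qed

definition matches :: "bool list set \<Rightarrow> pattern3 \<Rightarrow> bool" where
  "matches H q \<longleftrightarrow> (\<exists>a b c. \<forall>x y z. q (x \<noteq> a) (y \<noteq> b) (z \<noteq> c) \<longleftrightarrow> [x, y, z] \<in> H)"

text \<open>Together with the eight translations inside \<open>matches\<close>, the six permutations
  exhaust the 48 automorphisms of the 3-cube.\<close>

definition iso_pattern :: "bool list set \<Rightarrow> pattern3 \<Rightarrow> bool" where
  "iso_pattern H p \<longleftrightarrow> matches H p \<or> matches H (\<lambda>x y z. p x z y) \<or> matches H (\<lambda>x y z. p y x z) \<or>
     matches H (\<lambda>x y z. p y z x) \<or> matches H (\<lambda>x y z. p z x y) \<or> matches H (\<lambda>x y z. p z y x)"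

lemma pattern_permute:
  "pattern S v i k j = (\<lambda>x y z. pattern S v i j k x z y)"
  "pattern S v j i k = (\<lambda>x y z. pattern S v i j k y x z)"
  "pattern S v j k i = (\<lambda>x y z. pattern S v i j k z x y)"
  "pattern S v k i j = (\<lambda>x y z. pattern S v i j k y z x)"
  "pattern S v k j i = (\<lambda>x y z. pattern S v i j k z y x)"
  by (simp_all add: fun_eq_iff pattern_def flip_if_commute)

lemma gives_copy_iff:
  assumes v: "v \<in> cube n" and lt: "i < n" "j < n" "k < n" and dist: "distinct [i, j, k]"
    and H: "H \<subseteq> cube 3"
  shows "gives_copy 3 H S (face n {i, j, k} v) \<longleftrightarrow> iso_pattern H (pattern S v i j k)"
proof
  assume "gives_copy 3 H S (face n {i, j, k} v)"
  then obtain w i' j' k' where w: "w \<in> face n {i, j, k} v" "{i', j', k'} = {i, j, k}"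
      "distinct [i', j', k']" "\<And>x y z. pattern S w i' j' k' x y z \<longleftrightarrow> [x, y, z] \<in> H"
    using gives_copyE[OF v lt dist H] by metis
  then have "i' \<in> {i, j, k}" "j' \<in> {i, j, k}" "k' \<in> {i, j, k}" by blast+
  moreover have "matches H (pattern S v i' j' k')"
  proof -
    have "i' < n" "j' < n" "k' < n" "w \<in> face n {i', j', k'} v" using calculation lt w by auto
    then obtain a b c where
        "pattern S w i' j' k' = (\<lambda>x y z. pattern S v i' j' k' (x \<noteq> a) (y \<noteq> b) (z \<noteq> c))"
      using pattern_face[OF v] by metis
    then show ?thesis using w(4) unfolding matches_def by auto
  qed
  ultimately show "iso_pattern H (pattern S v i j k)"
    using w(3) dist unfolding iso_pattern_def
    by (elim insertE) (simp_all add: pattern_permute[where i = i and j = j and k = k])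
next
  assume "iso_pattern H (pattern S v i j k)"
  then have "\<exists>i' j' k'. {i', j', k'} = {i, j, k} \<and> distinct [i', j', k'] \<and> matches H (pattern S v i' j' k')"
    using dist unfolding iso_pattern_def pattern_permute[where i = i and j = j and k = k, symmetric]
    by (elim disjE)
      (rule exI[of _ i] exI[of _ j] exI[of _ k], rule exI[of _ j] exI[of _ i] exI[of _ k], auto)+
  then obtain i' j' k' where p: "{i', j', k'} = {i, j, k}" "distinct [i', j', k']"
      "matches H (pattern S v i' j' k')"
    by blast
  then have lt': "i' < n" "j' < n" "k' < n" using lt by auto
  obtain a b c where m: "\<And>x y z. pattern S v i' j' k' (x \<noteq> a) (y \<noteq> b) (z \<noteq> c) \<longleftrightarrow> [x, y, z] \<in> H"
    using p(3) unfolding matches_def by blast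
  define w where "w = flip_if a i' (flip_if b j' (flip_if c k' v))"
  have "w \<in> cube n" using v by (simp add: w_def)
  moreover have "pattern S w i' j' k' x y z \<longleftrightarrow> [x, y, z] \<in> H" for x y z
  proof -
    have "flip_if x i' (flip_if y j' (flip_if z k' w)) =
        flip_if (x \<noteq> a) i' (flip_if (y \<noteq> b) j' (flip_if (z \<noteq> c) k' v))"
      unfolding w_def by (rule nth_equalityI) (auto simp: nth_flip_if)
    then show ?thesis using m by (simp add: pattern_def)
  qed
  ultimately have "gives_copy 3 H S (face n {i', j', k'} w)"
    using gives_copyI[OF _ lt' p(2) H] by blast
  moreover have "w \<in> face n {i', j', k'} v"
    unfolding face_three[OF v lt'] w_def by (rule image_eqI[of _ _ "(a, b, c)"]) auto
  then have "face n {i', j', k'} v = face n {i', j', k'} w"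
    using v lt' \<open>w \<in> cube n\<close> by (subst face_eq_iff) auto
  ultimately show "gives_copy 3 H S (face n {i, j, k} v)" by (simp add: p(1))
qed

section \<open>Sums over rooted four-cubes\<close>

definition pattern4 :: "bool list set \<Rightarrow> bool list \<Rightarrow> nat \<Rightarrow> nat \<Rightarrow> nat \<Rightarrow> nat \<Rightarrow> pattern4" where
  "pattern4 S v i j k l x y z u \<longleftrightarrow> flip_if x i (flip_if y j (flip_if z k (flip_if u l v))) \<in> S"

text \<open>The directions need not be distinct.\<close>

definition pattern_sum :: "nat \<Rightarrow> bool list set \<Rightarrow> (pattern4 \<Rightarrow> int) \<Rightarrow> int" where
  "pattern_sum n S h =
    (\<Sum>(v, i, j, k, l) \<in> cube n \<times> {..<n} \<times> {..<n} \<times> {..<n} \<times> {..<n}. h (pattern4 S v i j k l))"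

lemma pattern_sum_add: "pattern_sum n S (\<lambda>p. g p + h p) = pattern_sum n S g + pattern_sum n S h"
  by (simp add: pattern_sum_def sum.distrib split_def)

lemma pattern_sum_cmult: "pattern_sum n S (\<lambda>p. c * h p) = c * pattern_sum n S h"
  by (simp add: pattern_sum_def sum_distrib_left split_def)

lemma pattern_sum_sum: "pattern_sum n S (\<lambda>p. \<Sum>a\<in>A. h a p) = (\<Sum>a\<in>A. pattern_sum n S (h a))"
  unfolding pattern_sum_def split_def by (rule sum.swap)

lemma pattern_sum_mono: "(\<And>p. g p \<le> h p) \<Longrightarrow> pattern_sum n S g \<le> pattern_sum n S h"
  unfolding pattern_sum_def by (rule sum_mono) auto

lemma pattern_sum_const: "pattern_sum n S (\<lambda>p. c) = c * (2 ^ n * int n ^ 4)"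
  by (simp add: pattern_sum_def card_cartesian_product card_cube power4_eq_xxxx)

section \<open>Symmetries of the pattern sum\<close>

lemma pattern_sum_not:
  "pattern_sum n S (\<lambda>p. h (\<lambda>x y z u. p (\<not> x) y z u)) = pattern_sum n S h"
  "pattern_sum n S (\<lambda>p. h (\<lambda>x y z u. p x (\<not> y) z u)) = pattern_sum n S h"
  "pattern_sum n S (\<lambda>p. h (\<lambda>x y z u. p x y (\<not> z) u)) = pattern_sum n S h"
  "pattern_sum n S (\<lambda>p. h (\<lambda>x y z u. p x y z (\<not> u))) = pattern_sum n S h"
proof -
  \<comment> \<open>Flips commute and are involutions, so these identities hold for repeated
    directions as well; moving the root is then a bijection of the whole index set.\<close>
  have "pattern4 S (flip i v) i j k l = (\<lambda>x y z u. pattern4 S v i j k l (\<not> x) y z u)"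
    "pattern4 S (flip j v) i j k l = (\<lambda>x y z u. pattern4 S v i j k l x (\<not> y) z u)"
    "pattern4 S (flip k v) i j k l = (\<lambda>x y z u. pattern4 S v i j k l x y (\<not> z) u)"
    "pattern4 S (flip l v) i j k l = (\<lambda>x y z u. pattern4 S v i j k l x y z (\<not> u))" for v i j k l
    unfolding fun_eq_iff pattern4_def
    by (intro allI arg_cong[of _ _ "\<lambda>w. w \<in> S"] nth_equalityI; auto simp: nth_flip_if nth_flip simp del: flip_if_simps)+
  note eqs = this
  show "pattern_sum n S (\<lambda>p. h (\<lambda>x y z u. p (\<not> x) y z u)) = pattern_sum n S h"
    unfolding pattern_sum_def
    by (rule sum.reindex_bij_witness[of _ "\<lambda>(v, i, j, k, l). (flip i v, i, j, k, l)"
          "\<lambda>(v, i, j, k, l). (flip i v, i, j, k, l)"]) (auto simp: eqs)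
  show "pattern_sum n S (\<lambda>p. h (\<lambda>x y z u. p x (\<not> y) z u)) = pattern_sum n S h"
    unfolding pattern_sum_def
    by (rule sum.reindex_bij_witness[of _ "\<lambda>(v, i, j, k, l). (flip j v, i, j, k, l)"
          "\<lambda>(v, i, j, k, l). (flip j v, i, j, k, l)"]) (auto simp: eqs)
  show "pattern_sum n S (\<lambda>p. h (\<lambda>x y z u. p x y (\<not> z) u)) = pattern_sum n S h"
    unfolding pattern_sum_def
    by (rule sum.reindex_bij_witness[of _ "\<lambda>(v, i, j, k, l). (flip k v, i, j, k, l)"
          "\<lambda>(v, i, j, k, l). (flip k v, i, j, k, l)"]) (auto simp: eqs)
  show "pattern_sum n S (\<lambda>p. h (\<lambda>x y z u. p x y z (\<not> u))) = pattern_sum n S h"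
    unfolding pattern_sum_def
    by (rule sum.reindex_bij_witness[of _ "\<lambda>(v, i, j, k, l). (flip l v, i, j, k, l)"
          "\<lambda>(v, i, j, k, l). (flip l v, i, j, k, l)"]) (auto simp: eqs)
qed

lemma pattern_sum_swap:
  "pattern_sum n S (\<lambda>p. h (\<lambda>x y z u. p y x z u)) = pattern_sum n S h"
  "pattern_sum n S (\<lambda>p. h (\<lambda>x y z u. p x z y u)) = pattern_sum n S h"
  "pattern_sum n S (\<lambda>p. h (\<lambda>x y z u. p x y u z)) = pattern_sum n S h"
proof -
  have eqs: "pattern4 S v j i k l = (\<lambda>x y z u. pattern4 S v i j k l y x z u)"
    "pattern4 S v i k j l = (\<lambda>x y z u. pattern4 S v i j k l x z y u)"
    "pattern4 S v i j l k = (\<lambda>x y z u. pattern4 S v i j k l x y u z)" for v i j k l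
    by (simp_all add: fun_eq_iff pattern4_def flip_if_commute)
  show "pattern_sum n S (\<lambda>p. h (\<lambda>x y z u. p y x z u)) = pattern_sum n S h"
    unfolding pattern_sum_def
    by (rule sum.reindex_bij_witness[of _ "\<lambda>(v, i, j, k, l). (v, j, i, k, l)"
          "\<lambda>(v, i, j, k, l). (v, j, i, k, l)"]) (auto simp: eqs(1)[symmetric])
  show "pattern_sum n S (\<lambda>p. h (\<lambda>x y z u. p x z y u)) = pattern_sum n S h"
    unfolding pattern_sum_def
    by (rule sum.reindex_bij_witness[of _ "\<lambda>(v, i, j, k, l). (v, i, k, j, l)"
          "\<lambda>(v, i, j, k, l). (v, i, k, j, l)"]) (auto simp: eqs(2)[symmetric])
  show "pattern_sum n S (\<lambda>p. h (\<lambda>x y z u. p x y u z)) = pattern_sum n S h"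
    unfolding pattern_sum_def
    by (rule sum.reindex_bij_witness[of _ "\<lambda>(v, i, j, k, l). (v, i, j, l, k)"
          "\<lambda>(v, i, j, k, l). (v, i, j, l, k)"]) (auto simp: eqs(3)[symmetric])
qed

definition shift4 :: "bool \<Rightarrow> bool \<Rightarrow> bool \<Rightarrow> bool \<Rightarrow> pattern4 \<Rightarrow> pattern4" where
  "shift4 a b c d p = (\<lambda>x y z u. p (x \<noteq> a) (y \<noteq> b) (z \<noteq> c) (u \<noteq> d))"

lemma pattern_sum_shift4: "pattern_sum n S (\<lambda>p. h (shift4 a b c d p)) = pattern_sum n S h"
proof -
  have 1: "pattern_sum n S (\<lambda>p. h (\<lambda>x y z u. p (x \<noteq> a) y z u)) = pattern_sum n S h" for h
    by (cases a) (simp_all add: pattern_sum_not(1))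
  have 2: "pattern_sum n S (\<lambda>p. h (\<lambda>x y z u. p x (y \<noteq> b) z u)) = pattern_sum n S h" for h
    by (cases b) (simp_all add: pattern_sum_not(2))
  have 3: "pattern_sum n S (\<lambda>p. h (\<lambda>x y z u. p x y (z \<noteq> c) u)) = pattern_sum n S h" for h
    by (cases c) (simp_all add: pattern_sum_not(3))
  have 4: "pattern_sum n S (\<lambda>p. h (\<lambda>x y z u. p x y z (u \<noteq> d))) = pattern_sum n S h" for h
    by (cases d) (simp_all add: pattern_sum_not(4))
  have "pattern_sum n S h = pattern_sum n S (\<lambda>p. h (\<lambda>x y z u. p (x \<noteq> a) (y \<noteq> b) (z \<noteq> c) (u \<noteq> d)))"
    by (subst 1[of h, symmetric], subst 2[symmetric], subst 3[symmetric], subst 4[symmetric]) simp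
  then show ?thesis by (simp add: shift4_def)
qed

section \<open>Squares and facets\<close>

lemma pattern4_facets:
  "(\<lambda>x y z. pattern4 S v i j k l x y z False) = pattern S v i j k"
  "(\<lambda>x y z. pattern4 S v i j k l x y False z) = pattern S v i j l"
  by (simp_all add: fun_eq_iff pattern4_def pattern_def)

text \<open>The two facets share the root and two directions, while their third directions
  \<open>k\<close> and \<open>l\<close> run independently. The diagonal \<open>k = l\<close> belongs
  to the sum, so the double sum is a square with no correction term.\<close>

lemma pattern_sum_square_nonneg:
  "0 \<le> pattern_sum n S (\<lambda>p. g (\<lambda>x y z. p x y z False) * g (\<lambda>x y z. p x y False z))"
proof -
  have "pattern_sum n S (\<lambda>p. g (\<lambda>x y z. p x y z False) * g (\<lambda>x y z. p x y False z)) =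
    (\<Sum>v\<in>cube n. \<Sum>i<n. \<Sum>j<n. \<Sum>k<n. \<Sum>l<n. g (pattern S v i j k) * g (pattern S v i j l))"
    by (simp only: pattern_sum_def sum.cartesian_product pattern4_facets)
  also have "\<dots> = (\<Sum>v\<in>cube n. \<Sum>i<n. \<Sum>j<n. (\<Sum>k<n. g (pattern S v i j k)) * (\<Sum>l<n. g (pattern S v i j l)))"
    by (simp add: sum_product)
  also have "\<dots> \<ge> 0" by (intro sum_nonneg) simp
  finally show ?thesis .
qed

lemma pattern_sum_facet:
  "pattern_sum n S (\<lambda>p. g (\<lambda>x y z. p x y z False)) =
    int n * (\<Sum>(v, i, j, k) \<in> cube n \<times> {..<n} \<times> {..<n} \<times> {..<n}. g (pattern S v i j k))"
proof -
  have "pattern_sum n S (\<lambda>p. g (\<lambda>x y z. p x y z False)) =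
    (\<Sum>v\<in>cube n. \<Sum>i<n. \<Sum>j<n. \<Sum>k<n. \<Sum>l<n. g (pattern S v i j k))"
    by (simp only: pattern_sum_def sum.cartesian_product pattern4_facets)
  also have "\<dots> = int n * (\<Sum>v\<in>cube n. \<Sum>i<n. \<Sum>j<n. \<Sum>k<n. g (pattern S v i j k))"
    by (simp add: sum_distrib_left)
  finally show ?thesis by (simp add: sum.cartesian_product)
qed

lemma Lambda_set_le:
  assumes H: "H \<subseteq> cube 3" and n: "n > 0" and N: "N \<ge> 0"
    and le: "N * pattern_sum n S (\<lambda>p. of_bool (iso_pattern H (\<lambda>x y z. p x y z False))) \<le> M * (2 ^ n * int n ^ 4)"
  shows "N * (48 * int (Lambda_set 3 H n S)) \<le> M * (2 ^ n * int n ^ 3)"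
proof -
  define X where "X = (\<Sum>(v, i, j, k) \<in> cube n \<times> {..<n} \<times> {..<n} \<times> {..<n}.
    of_bool (iso_pattern H (pattern S v i j k)) :: int)"
  have "48 * int (Lambda_set 3 H n S) =
      (\<Sum>t\<in>{(v, i, j, k) \<in> triples n. gives_copy 3 H S (face n {i, j, k} v)}. 1)"
    by (simp add: card_copies)
  also have "\<dots> \<le> (\<Sum>(v, i, j, k) \<in> {(v, i, j, k) \<in> triples n. gives_copy 3 H S (face n {i, j, k} v)}.
      of_bool (iso_pattern H (pattern S v i j k)))"
    by (rule sum_mono) (auto simp: triples_def gives_copy_iff[OF _ _ _ _ _ H])
  \<comment> \<open>The only loss of the argument: triples with a repeated direction are added, with
    nonnegative terms.\<close>
  also have "\<dots> \<le> X"
    unfolding X_def by (rule sum_mono2) (auto simp: triples_def)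
  finally have 1: "48 * int (Lambda_set 3 H n S) \<le> X" .
  have "N * (int n * X) \<le> M * (2 ^ n * int n ^ 4)"
    using le unfolding pattern_sum_facet[of n S "\<lambda>q. of_bool (iso_pattern H q)"] X_def by simp
  then have "int n * (N * X) \<le> int n * (M * (2 ^ n * int n ^ 3))"
    by (simp add: algebra_simps power4_eq_xxxx power3_eq_cube)
  then have "N * X \<le> M * (2 ^ n * int n ^ 3)" using n by simp
  moreover have "N * (48 * int (Lambda_set 3 H n S)) \<le> N * X" using 1 N by (intro mult_left_mono)
  ultimately show ?thesis by simp
qed

section \<open>Certificates on three-cubes\<close>

definition shift :: "bool \<Rightarrow> bool \<Rightarrow> bool \<Rightarrow> pattern3 \<Rightarrow> pattern3" where
  "shift a b c p = (\<lambda>x y z. p (x \<noteq> a) (y \<noteq> b) (z \<noteq> c))"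

definition oct :: "bool \<Rightarrow> bool \<Rightarrow> bool \<Rightarrow> bool \<Rightarrow> bool \<Rightarrow> bool \<Rightarrow> bool \<Rightarrow> bool \<Rightarrow> pattern3" where
  "oct b0 b1 b2 b3 b4 b5 b6 b7 = (\<lambda>x y z.
    (if x then if y then if z then b7 else b6 else if z then b5 else b4
     else if y then if z then b3 else b2 else if z then b1 else b0))"

type_synonym edge_form = "bool \<times> bool \<times> int \<times> int \<times> int \<times> int"

text \<open>
  A form (s, t, c0, c1, c2, c3) lives on the edges whose ends have colours s and t. A direction k is scored by the
  colours y, z of the ends of the parallel edge shifted by k, with weights c0, c1, c2, c3 for (y, z) = 00, 10, 01, 11.
\<close>

fun edge_form :: "edge_form \<Rightarrow> bool \<Rightarrow> bool \<Rightarrow> bool \<Rightarrow> bool \<Rightarrow> int" where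
  "edge_form (s, t, c0, c1, c2, c3) a b y z =
    (if a = s \<and> b = t then if z then if y then c3 else c2 else if y then c1 else c0 else 0)"

definition edge_kernel :: "(int \<times> edge_form) list \<Rightarrow> bool \<Rightarrow> bool \<Rightarrow> bool \<Rightarrow> bool \<Rightarrow> bool \<Rightarrow> bool \<Rightarrow> int" where
  "edge_kernel cs a b y z y' z' = (\<Sum>(w, f)\<leftarrow>cs. w * (edge_form f a b y z * edge_form f a b y' z'))"

definition certificate :: "(int \<times> edge_form) list \<Rightarrow> pattern3 \<Rightarrow> int" where
  "certificate cs q = edge_kernel cs (q False False False) (q True False False) (q False True False)
     (q True True False) (q False False True) (q True False True)"
text \<open>Three permutations suffice: each direction gets its turn as the direction of the edge,
  and exchanging the other two leaves \<open>edge_kernel\<close> unchanged. With the eight shifts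
  this is a sum over the 24 rooted edges of the 3-cube.\<close>

definition symmetrized :: "(pattern3 \<Rightarrow> int) \<Rightarrow> pattern3 \<Rightarrow> int" where
  "symmetrized h q = (\<Sum>a\<in>UNIV. \<Sum>b\<in>UNIV. \<Sum>c\<in>UNIV. h (shift a b c q) + h (shift a b c (\<lambda>x y z. q y x z))
     + h (shift a b c (\<lambda>x y z. q y z x)))"

lemma sum_bool: "(\<Sum>a\<in>UNIV. g a) = g False + g True" for g :: "bool \<Rightarrow> int"
  by (simp add: UNIV_bool)

lemma pattern3_cases:
  assumes "\<And>b0 b1 b2 b3 b4 b5 b6 b7. P (oct b0 b1 b2 b3 b4 b5 b6 b7)"
  shows "P q"
proof -
  have "q = oct (q False False False) (q False False True) (q False True False) (q False True True)
    (q True False False) (q True False True) (q True True False) (q True True True)"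
    by (auto simp: fun_eq_iff oct_def)
  then show ?thesis using assms by metis
qed

lemma oct_simps:
  "oct b0 b1 b2 b3 b4 b5 b6 b7 False False False = b0"
  "oct b0 b1 b2 b3 b4 b5 b6 b7 False False True = b1"
  "oct b0 b1 b2 b3 b4 b5 b6 b7 False True False = b2"
  "oct b0 b1 b2 b3 b4 b5 b6 b7 False True True = b3"
  "oct b0 b1 b2 b3 b4 b5 b6 b7 True False False = b4"
  "oct b0 b1 b2 b3 b4 b5 b6 b7 True False True = b5"
  "oct b0 b1 b2 b3 b4 b5 b6 b7 True True False = b6"
  "oct b0 b1 b2 b3 b4 b5 b6 b7 True True True = b7"
  by (simp_all add: oct_def)

lemma pattern_sum_facets:
  "pattern_sum n S (\<lambda>p. g (\<lambda>x y z. p x y z b)) = pattern_sum n S (\<lambda>p. g (\<lambda>x y z. p x y z False))"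
  "pattern_sum n S (\<lambda>p. g (\<lambda>x y z. p x y b z)) = pattern_sum n S (\<lambda>p. g (\<lambda>x y z. p x y z False))"
  "pattern_sum n S (\<lambda>p. g (\<lambda>x y z. p x b y z)) = pattern_sum n S (\<lambda>p. g (\<lambda>x y z. p x y z False))"
  "pattern_sum n S (\<lambda>p. g (\<lambda>x y z. p b x y z)) = pattern_sum n S (\<lambda>p. g (\<lambda>x y z. p x y z False))"
proof -
  let ?G = "pattern_sum n S (\<lambda>p. g (\<lambda>x y z. p x y z False))"
  show 4: "pattern_sum n S (\<lambda>p. g (\<lambda>x y z. p x y z b)) = ?G"
    using pattern_sum_shift4[of n S "\<lambda>p. g (\<lambda>x y z. p x y z b)" False False False b]
    by (simp add: shift4_def)
  show 3: "pattern_sum n S (\<lambda>p. g (\<lambda>x y z. p x y b z)) = ?G"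
    using pattern_sum_swap(3)[of n S "\<lambda>p. g (\<lambda>x y z. p x y b z)"] 4 by simp
  show 2: "pattern_sum n S (\<lambda>p. g (\<lambda>x y z. p x b y z)) = ?G"
    using pattern_sum_swap(2)[of n S "\<lambda>p. g (\<lambda>x y z. p x b y z)"] 3 by simp
  show "pattern_sum n S (\<lambda>p. g (\<lambda>x y z. p b x y z)) = ?G"
    using pattern_sum_swap(1)[of n S "\<lambda>p. g (\<lambda>x y z. p b x y z)"] 2 by simp
qed

lemma pattern_sum_symmetrized:
  "pattern_sum n S (\<lambda>p. symmetrized g (\<lambda>x y z. p x y z False)) =
    24 * pattern_sum n S (\<lambda>p. g (\<lambda>x y z. p x y z False))"
proof -
  have 1: "pattern_sum n S (\<lambda>p. g (shift a b c (\<lambda>x y z. p x y z False))) =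
      pattern_sum n S (\<lambda>p. g (\<lambda>x y z. p x y z False))" for a b c and g :: "pattern3 \<Rightarrow> int"
    using pattern_sum_shift4[of n S "\<lambda>p. g (\<lambda>x y z. p x y z False)" a b c False]
    by (simp add: shift4_def shift_def)
  have 2: "pattern_sum n S (\<lambda>p. g (\<lambda>x y z. p y x z False)) =
      pattern_sum n S (\<lambda>p. g (\<lambda>x y z. p x y z False))" for g :: "pattern3 \<Rightarrow> int"
    using pattern_sum_swap(1)[of n S "\<lambda>p. g (\<lambda>x y z. p x y z False)"] by simp
  have 3: "pattern_sum n S (\<lambda>p. g (\<lambda>x y z. p y z x False)) =
      pattern_sum n S (\<lambda>p. g (\<lambda>x y z. p x y z False))" for g :: "pattern3 \<Rightarrow> int"
    using pattern_sum_swap(2)[of n S "\<lambda>p. g (\<lambda>x y z. p y x z False)"] 2[of g] by simp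
  have "pattern_sum n S (\<lambda>p. g (shift a b c (\<lambda>x y z. p y x z False))) =
      pattern_sum n S (\<lambda>p. g (\<lambda>x y z. p x y z False))"
    "pattern_sum n S (\<lambda>p. g (shift a b c (\<lambda>x y z. p y z x False))) =
      pattern_sum n S (\<lambda>p. g (\<lambda>x y z. p x y z False))" for a b c
    using 2[of "\<lambda>q. g (shift a b c q)"] 3[of "\<lambda>q. g (shift a b c q)"] 1[of g a b c] by simp_all
  then show ?thesis
    by (simp add: symmetrized_def pattern_sum_sum pattern_sum_add 1)
qed

lemma pattern_sum_certificate_nonneg:
  assumes "\<forall>(w, f) \<in> set cs. w \<ge> 0"
  shows "0 \<le> pattern_sum n S (\<lambda>p. certificate cs (\<lambda>x y z. p x y z False))"
proof -
  \<comment> \<open>The facet is turned so that the edge has the first direction and its two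
    parallel shifts the last two; the second stays free. This is the shape of
    \<open>pattern_sum_square_nonneg\<close>.\<close>
  have "0 \<le> pattern_sum n S (\<lambda>p. certificate cs (\<lambda>x y z. p x False y z))"
    using assms
  proof (induction cs)
    case Nil
    then show ?case by (simp add: certificate_def edge_kernel_def pattern_sum_def)
  next
    case (Cons t cs)
    obtain w f where t: "t = (w, f)" by (cases t)
    define g where "g q = edge_form f (q False False False) (q True False False) (q False False True) (q True False True)"
      for q
    have "pattern_sum n S (\<lambda>p. certificate (t # cs) (\<lambda>x y z. p x False y z)) =
       w * pattern_sum n S (\<lambda>p. g (\<lambda>x y z. p x y z False) * g (\<lambda>x y z. p x y False z)) +
       pattern_sum n S (\<lambda>p. certificate cs (\<lambda>x y z. p x False y z))"
      by (simp add: certificate_def edge_kernel_def t g_def pattern_sum_add pattern_sum_cmult)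
    moreover have "0 \<le> w" "0 \<le> pattern_sum n S (\<lambda>p. certificate cs (\<lambda>x y z. p x False y z))"
      using Cons by (auto simp: t)
    ultimately show ?case using pattern_sum_square_nonneg[of n S g] by simp
  qed
  then show ?thesis using pattern_sum_facets(3)[of n S "certificate cs" False] by simp
qed

lemma Lambda_set_le_certificate:
  assumes H: "H \<subseteq> cube 3" and n: "n > 0" and N: "N \<ge> 0"
    and w: "\<forall>(w, f) \<in> set cs. w \<ge> 0"
    and le: "\<And>q. N * of_bool (iso_pattern H q) + symmetrized (certificate cs) q \<le> M"
  shows "N * (48 * int (Lambda_set 3 H n S)) \<le> M * (2 ^ n * int n ^ 3)"
proof (rule Lambda_set_le[OF H n N])
  let ?ind = "\<lambda>p. of_bool (iso_pattern H (\<lambda>x y z. p x y z False)) :: int"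
  have "pattern_sum n S (\<lambda>p. N * ?ind p + symmetrized (certificate cs) (\<lambda>x y z. p x y z False))
      \<le> pattern_sum n S (\<lambda>p. M)"
    by (rule pattern_sum_mono) (rule le)
  then show "N * pattern_sum n S ?ind \<le> M * (2 ^ n * int n ^ 4)"
    using pattern_sum_certificate_nonneg[OF w, of n S]
    by (simp add: pattern_sum_add pattern_sum_cmult pattern_sum_symmetrized pattern_sum_const)
qed

section \<open>The upper bound for W8\<close>

definition star :: "pattern3 \<Rightarrow> bool" where
  "star q \<longleftrightarrow> \<not> q False False False \<and> q True False False \<and> q False True False \<and> q False False True \<and>
    \<not> q True True False \<and> \<not> q True False True \<and> \<not> q False True True \<and> \<not> q True True True"

definition shifted_star :: "pattern3 \<Rightarrow> bool" where
  "shifted_star q \<longleftrightarrow> (\<exists>a b c. star (shift a b c q))"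

text \<open>The two possible centres are opposite corners of a 2-face. In the modulo 3 colouring
  they have residues 2 and 1, so one is completed by the upward directions and the other by the
  downward ones. At a typical vertex these are equally many, which makes the sum over the third
  direction vanish to leading order.\<close>

definition star_difference :: "pattern3 \<Rightarrow> int" where
  "star_difference q = of_bool (star q) - of_bool (star (shift True True False q))"

text \<open>The copy of W8 formed by the neighbours of the centre (a, b, c). Its symmetry under
  permutations leaves only eight labelled copies, one for each centre.\<close>

definition star_pattern :: "bool \<Rightarrow> bool \<Rightarrow> bool \<Rightarrow> pattern3" where
  "star_pattern a b c = shift a b c
    (\<lambda>x y z. x \<and> \<not> y \<and> \<not> z \<or> \<not> x \<and> y \<and> \<not> z \<or> \<not> x \<and> \<not> y \<and> z)"

lemma shift_shift: "shift a b c (shift a' b' c' q) = shift (a \<noteq> a') (b \<noteq> b') (c \<noteq> c') q"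
  by (cases a; cases a'; cases b; cases b'; cases c; cases c'; simp add: shift_def)

lemma star_shift_iff: "star (shift a b c q) \<longleftrightarrow> q = star_pattern a b c"
proof
  assume "star (shift a b c q)"
  then have "shift a b c q = (\<lambda>x y z. x \<and> \<not> y \<and> \<not> z \<or> \<not> x \<and> y \<and> \<not> z \<or> \<not> x \<and> \<not> y \<and> z)"
    by (auto simp: fun_eq_iff all_bool_eq star_def)
  then have "shift a b c (shift a b c q) = star_pattern a b c" by (simp add: star_pattern_def)
  moreover have "shift a b c (shift a b c q) = q" by (simp add: shift_shift) (simp add: shift_def)
  ultimately show "q = star_pattern a b c" by simp
next
  have "star (shift a b c (star_pattern a b c))"
    by (cases a; cases b; cases c; simp add: star_pattern_def shift_def star_def)
  moreover assume "q = star_pattern a b c"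
  ultimately show "star (shift a b c q)" by simp
qed

lemma star_pattern_eq_iff: "star_pattern a b c = star_pattern a' b' c' \<longleftrightarrow> a = a' \<and> b = b' \<and> c = c'"
proof
  assume "star_pattern a b c = star_pattern a' b' c'"
  then show "a = a' \<and> b = b' \<and> c = c'"
    by (cases a; cases b; cases c; cases a'; cases b'; cases c';
      simp add: fun_eq_iff all_bool_eq star_pattern_def shift_def)
qed simp

lemma shifted_star_iff: "shifted_star q \<longleftrightarrow> (\<exists>a b c. q = star_pattern a b c)"
  by (simp add: shifted_star_def star_shift_iff)

lemma shifted_star_permute:
  "shifted_star (\<lambda>x y z. q y x z) = shifted_star q" "shifted_star (\<lambda>x y z. q x z y) = shifted_star q"
  "shifted_star (\<lambda>x y z. q y z x) = shifted_star q" "shifted_star (\<lambda>x y z. q z x y) = shifted_star q"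
  "shifted_star (\<lambda>x y z. q z y x) = shifted_star q"
proof -
  have "star (shift a b c (\<lambda>x y z. q y x z)) = star (shift b a c q)"
    "star (shift a b c (\<lambda>x y z. q x z y)) = star (shift a c b q)"
    "star (shift a b c (\<lambda>x y z. q y z x)) = star (shift b c a q)"
    "star (shift a b c (\<lambda>x y z. q z x y)) = star (shift c a b q)"
    "star (shift a b c (\<lambda>x y z. q z y x)) = star (shift c b a q)" for a b c
    unfolding star_def shift_def by blast+
  then show "shifted_star (\<lambda>x y z. q y x z) = shifted_star q" "shifted_star (\<lambda>x y z. q x z y) = shifted_star q"
    "shifted_star (\<lambda>x y z. q y z x) = shifted_star q" "shifted_star (\<lambda>x y z. q z x y) = shifted_star q"
    "shifted_star (\<lambda>x y z. q z y x) = shifted_star q"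
    unfolding shifted_star_def by meson+
qed

lemma iso_pattern_W8: "iso_pattern W8 q \<longleftrightarrow> shifted_star q"
proof -
  have "matches W8 q \<longleftrightarrow> shifted_star q" for q
    unfolding matches_def shifted_star_def star_def shift_def W8_def
    by (intro ex_cong1) (auto simp: all_bool_eq)
  then show ?thesis by (simp add: iso_pattern_def shifted_star_permute[of q])
qed

lemma star_difference_shift:
  "star_difference (shift a b c q) = of_bool (q = star_pattern a b c) - of_bool (q = star_pattern (\<not> a) (\<not> b) c)"
  by (simp add: star_difference_def shift_shift star_shift_iff)

text \<open>A copy has a single centre, so at most two of the four shifts contribute to each factor:
  the centre with +1 and the opposite corner of the 2-face with -1. Two copies thus give 2, -2 or
  0.\<close>

lemma star_difference_products_le:
  "(\<Sum>a\<in>UNIV. \<Sum>b\<in>UNIV. star_difference (shift a b c q) * star_difference (shift a b d q'))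
    \<le> 2 * of_bool (shifted_star q \<and> shifted_star q')"
proof (cases "shifted_star q \<and> shifted_star q'")
  case True
  then obtain a b c' a' b' d' where "q = star_pattern a b c'" "q' = star_pattern a' b' d'"
    by (auto simp: shifted_star_iff)
  then show ?thesis
    using True by (cases a; cases b; cases a'; cases b'; simp add: star_difference_shift star_pattern_eq_iff sum_bool)
next
  case False
  then have "star_difference (shift a b c q) = 0 \<or> star_difference (shift a b d q') = 0" for a b
    by (auto simp: star_difference_shift shifted_star_iff)
  then have "star_difference (shift a b c q) * star_difference (shift a b d q') = 0" for a b by simp
  then show ?thesis by (simp only: sum.neutral_const) simp
qed

section \<open>Pairs of facets of a 4-cube\<close>

definition facet_product :: "pattern4 \<Rightarrow> int" where
  "facet_product p = star_difference (\<lambda>x y z. p x y z False) * star_difference (\<lambda>x y z. p x y False z)"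

definition facet_products :: "pattern4 \<Rightarrow> int" where
  "facet_products p = (\<Sum>a\<in>UNIV. \<Sum>b\<in>UNIV. \<Sum>c\<in>UNIV. \<Sum>d\<in>UNIV. facet_product (shift4 a b c d p))"

definition star_count :: "(bool \<Rightarrow> pattern3) \<Rightarrow> int" where
  "star_count f = (\<Sum>b\<in>UNIV. of_bool (shifted_star (f b)))"

definition star_facets :: "pattern4 \<Rightarrow> int" where
  "star_facets p = star_count (\<lambda>b x y z. p x y z b) + star_count (\<lambda>b x y z. p x y b z)
     + star_count (\<lambda>b x y z. p x b y z) + star_count (\<lambda>b x y z. p b x y z)"

text \<open>The weight 9 is forced by the modulo 3 colouring. Its 4-cubes with layers 0 and 3, or 1
  and 4, coloured have 4 facets that are copies and products summing to 12; those with layer 2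
  coloured have 8 such facets and products summing to -24. Equality needs 4w + 12 = 8w - 24, so w =
  9 and the common value is 48.\<close>

definition facet_weight :: "pattern4 \<Rightarrow> int" where
  "facet_weight p = 9 * star_facets p
     + (facet_products p + facet_products (\<lambda>x y z u. p x z y u) + facet_products (\<lambda>x y z u. p x z u y)
      + facet_products (\<lambda>x y z u. p z x y u) + facet_products (\<lambda>x y z u. p z x u y) + facet_products (\<lambda>x y z u. p z u x y))"

lemma facet_products_alt:
  "facet_products p = (\<Sum>c\<in>UNIV. \<Sum>d\<in>UNIV. \<Sum>a\<in>UNIV. \<Sum>b\<in>UNIV.
     star_difference (shift a b c (\<lambda>x y z. p x y z d)) * star_difference (shift a b d (\<lambda>x y z. p x y c z)))"
proof -
  have "facet_product (shift4 a b c d p) =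
      star_difference (shift a b c (\<lambda>x y z. p x y z d)) * star_difference (shift a b d (\<lambda>x y z. p x y c z))" for a b c d
    by (simp add: facet_product_def shift4_def shift_def)
  then show ?thesis by (simp add: facet_products_def sum_bool)
qed

text \<open>Each pair consisting of one facet from either direction occurs once and is worth at most
  2.\<close>

lemma facet_products_le:
  "facet_products p \<le> 2 * star_count (\<lambda>b x y z. p x y z b) * star_count (\<lambda>b x y z. p x y b z)"
proof -
  have "facet_products p \<le> (\<Sum>c\<in>UNIV. \<Sum>d\<in>UNIV.
     2 * of_bool (shifted_star (\<lambda>x y z. p x y z d) \<and> shifted_star (\<lambda>x y z. p x y c z)))"
    unfolding facet_products_alt by (intro sum_mono star_difference_products_le)
  also have "\<dots> = 2 * star_count (\<lambda>b x y z. p x y z b) * star_count (\<lambda>b x y z. p x y b z)"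
    by (simp add: star_count_def sum_bool of_bool_conj algebra_simps)
  finally show ?thesis .
qed

text \<open>
  Without two opposite facets that are copies of W8 there are at most four such facets, and 9 * 4 + 2 * 6 = 48.
  Two opposite ones determine the whole 4-cube.
\<close>

lemma facet_weight_le_no_opposite:
  assumes "star_count (\<lambda>b x y z. p x y z b) \<noteq> 2" "star_count (\<lambda>b x y z. p x y b z) \<noteq> 2"
    and "star_count (\<lambda>b x y z. p x b y z) \<noteq> 2" "star_count (\<lambda>b x y z. p b x y z) \<noteq> 2"
  shows "facet_weight p \<le> 48"
proof -
  have perm: "star_count (\<lambda>b x y z. f b y x z) = star_count f" "star_count (\<lambda>b x y z. f b x z y) = star_count f"
    "star_count (\<lambda>b x y z. f b y z x) = star_count f" "star_count (\<lambda>b x y z. f b z x y) = star_count f"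
    "star_count (\<lambda>b x y z. f b z y x) = star_count f" for f
    unfolding star_count_def by (intro sum.cong refl arg_cong[of _ _ of_bool] shifted_star_permute)+
  define s1 s2 s3 s4 where "s1 = star_count (\<lambda>b x y z. p b x y z)" and "s2 = star_count (\<lambda>b x y z. p x b y z)"
    and "s3 = star_count (\<lambda>b x y z. p x y b z)" and "s4 = star_count (\<lambda>b x y z. p x y z b)"
  have range: "star_count f = 0 \<or> star_count f = 1 \<or> star_count f = 2" for f
    by (simp add: star_count_def sum_bool of_bool_def)
  have s: "s1 = 0 \<or> s1 = 1" "s2 = 0 \<or> s2 = 1" "s3 = 0 \<or> s3 = 1" "s4 = 0 \<or> s4 = 1"
    using range assms unfolding s1_def s2_def s3_def s4_def by blast+
  have f1: "facet_products p \<le> 2 * s4 * s3"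
    unfolding s3_def s4_def by (rule facet_products_le)
  have f2: "facet_products (\<lambda>x y z u. p x z y u) \<le> 2 * s4 * s2"
    using facet_products_le[of "\<lambda>x y z u. p x z y u"] unfolding perm(2)[of "\<lambda>b x y z. p x y z b"] s4_def s2_def .
  have f3: "facet_products (\<lambda>x y z u. p x z u y) \<le> 2 * s3 * s2"
    using facet_products_le[of "\<lambda>x y z u. p x z u y"]
    unfolding perm(2)[of "\<lambda>b x y z. p x y b z"] perm(2)[of "\<lambda>b x y z. p x b y z"] s3_def s2_def .
  have f4: "facet_products (\<lambda>x y z u. p z x y u) \<le> 2 * s4 * s1"
    using facet_products_le[of "\<lambda>x y z u. p z x y u"] unfolding perm(4)[of "\<lambda>b x y z. p x y z b"] s4_def s1_def .
  have f5: "facet_products (\<lambda>x y z u. p z x u y) \<le> 2 * s3 * s1"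
    using facet_products_le[of "\<lambda>x y z u. p z x u y"]
    unfolding perm(4)[of "\<lambda>b x y z. p x y b z"] perm(2)[of "\<lambda>b x y z. p b x y z"] s3_def s1_def .
  have f6: "facet_products (\<lambda>x y z u. p z u x y) \<le> 2 * s2 * s1"
    using facet_products_le[of "\<lambda>x y z u. p z u x y"]
    unfolding perm(4)[of "\<lambda>b x y z. p x b y z"] perm(4)[of "\<lambda>b x y z. p b x y z"] s2_def s1_def .
  have arith: "9 * (s4 + s3 + s2 + s1) + (f1 + f2 + f3 + f4 + f5 + f6) \<le> 48"
    if "s1 = 0 \<or> s1 = 1" "s2 = 0 \<or> s2 = 1" "s3 = 0 \<or> s3 = 1" "s4 = 0 \<or> s4 = 1"
      "f1 \<le> 2 * s4 * s3" "f2 \<le> 2 * s4 * s2" "f3 \<le> 2 * s3 * s2" "f4 \<le> 2 * s4 * s1" "f5 \<le> 2 * s3 * s1" "f6 \<le> 2 * s2 * s1"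
    for f1 f2 f3 f4 f5 f6 :: int
    using that by (elim disjE; simp)
  have "star_facets p = s4 + s3 + s2 + s1"
    by (simp only: star_facets_def s1_def s2_def s3_def s4_def)
  then show ?thesis unfolding facet_weight_def using arith[OF s f1 f2 f3 f4 f5 f6] by simp
qed

section \<open>Shift invariance, and 4-cubes with two opposite copies\<close>

lemma noteq_bool: "(False \<noteq> False) = False" "(True \<noteq> True) = False" "(True \<noteq> False) = True" "(False \<noteq> True) = True"
  by simp_all

lemma shifted_star_shift: "shifted_star (\<lambda>x y z. q (x \<noteq> a) (y \<noteq> b) (z \<noteq> c)) = shifted_star q"
proof -
  have "shifted_star (shift a b c q)" if q: "shifted_star q" for q
  proof -
    obtain a' b' c' where "star (shift a' b' c' q)" using q by (auto simp: shifted_star_def)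
    moreover have "((x \<noteq> y) \<noteq> y) = x" for x y :: bool by blast
    ultimately have "star (shift (a' \<noteq> a) (b' \<noteq> b) (c' \<noteq> c) (shift a b c q))" by (simp only: shift_shift)
    then show ?thesis unfolding shifted_star_def by blast
  qed
  from this[of q] this[of "shift a b c q"] have "shifted_star (shift a b c q) = shifted_star q"
    by (simp add: shift_shift) (auto simp: shift_def)
  then show ?thesis by (simp only: shift_def)
qed

lemma star_count_shift:
  "star_count (\<lambda>w x y z. f (w \<noteq> d) (x \<noteq> a) (y \<noteq> b) (z \<noteq> c)) = star_count f"
  unfolding star_count_def by (subst shifted_star_shift) (cases d; simp add: sum_bool)

lemma shift4_shift4:
  "shift4 a b c d (shift4 a' b' c' d' p) = shift4 (a \<noteq> a') (b \<noteq> b') (c \<noteq> c') (d \<noteq> d') p"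
  by (cases a; cases a'; cases b; cases b'; cases c; cases c'; cases d; cases d'; simp add: shift4_def)

lemma facet_products_shift: "facet_products (shift4 a b c d p) = facet_products p"
proof -
  have s: "(\<Sum>x\<in>UNIV. g (x \<noteq> e)) = (\<Sum>x\<in>UNIV. g x)" for g :: "bool \<Rightarrow> int" and e :: bool
    by (cases e; simp add: sum_bool)
  show ?thesis
    unfolding facet_products_def shift4_shift4
    by ((rule trans[OF s], rule sum.cong[OF refl])+, rule refl)
qed

lemma facet_weight_shift: "facet_weight (shift4 a b c d p) = facet_weight p"
proof -
  have perm: "(\<lambda>x y z u. shift4 a b c d p x z y u) = shift4 a c b d (\<lambda>x y z u. p x z y u)"
    "(\<lambda>x y z u. shift4 a b c d p x z u y) = shift4 a d b c (\<lambda>x y z u. p x z u y)"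
    "(\<lambda>x y z u. shift4 a b c d p z x y u) = shift4 b c a d (\<lambda>x y z u. p z x y u)"
    "(\<lambda>x y z u. shift4 a b c d p z x u y) = shift4 b d a c (\<lambda>x y z u. p z x u y)"
    "(\<lambda>x y z u. shift4 a b c d p z u x y) = shift4 c d a b (\<lambda>x y z u. p z u x y)"
    by (simp_all add: shift4_def)
  have "star_facets (shift4 a b c d p) = star_facets p"
    unfolding star_facets_def shift4_def
    using star_count_shift[of "\<lambda>b x y z. p x y z b" d a b c] star_count_shift[of "\<lambda>b x y z. p x y b z" c a b d]
      star_count_shift[of "\<lambda>b x y z. p x b y z" b a c d] star_count_shift[of "\<lambda>b x y z. p b x y z" a b c d]
    by simp
  then show ?thesis by (simp only: facet_weight_def perm facet_products_shift)
qed

lemmas facet_weight_unfold = facet_weight_def facet_products_def facet_product_def shift4_def star_facets_def star_count_def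
      star_difference_def shift_def shifted_star_def ex_bool_eq star_def sum_bool noteq_bool

text \<open>One of the two opposite copies can be assumed to have its centre at the origin. Eight
  centres remain for the other, each in four positions of the direction separating the two
  facets.\<close>

lemma facet_weight_opposite:
  assumes q: "\<And>u. q u = (if u then star_pattern a b c else star_pattern False False False)"
  shows "facet_weight (\<lambda>x y z u. q u x y z) \<le> 48" "facet_weight (\<lambda>x y z u. q z x y u) \<le> 48"
    "facet_weight (\<lambda>x y z u. q y x z u) \<le> 48" "facet_weight (\<lambda>x y z u. q x y z u) \<le> 48"
proof -
  note unfold = facet_weight_unfold q if_True if_False star_pattern_def
  show "facet_weight (\<lambda>x y z u. q u x y z) \<le> 48"
    by (simp only: unfold, simp only: simp_thms, cases a; cases b; cases c; simp)
  show "facet_weight (\<lambda>x y z u. q z x y u) \<le> 48"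
    by (simp only: unfold, simp only: simp_thms, cases a; cases b; cases c; simp)
  show "facet_weight (\<lambda>x y z u. q y x z u) \<le> 48"
    by (simp only: unfold, simp only: simp_thms, cases a; cases b; cases c; simp)
  show "facet_weight (\<lambda>x y z u. q x y z u) \<le> 48"
    by (simp only: unfold, simp only: simp_thms, cases a; cases b; cases c; simp)
qed

lemma star_count_2E:
  assumes "star_count f = 2"
  obtains a b c a' b' c' where
    "\<And>u. (\<lambda>x y z. f u (x \<noteq> a) (y \<noteq> b) (z \<noteq> c)) = (if u then star_pattern a' b' c' else star_pattern False False False)"
proof -
  have "shifted_star (f False)" "shifted_star (f True)"
    using assms by (auto simp: star_count_def sum_bool of_bool_def split: if_splits)
  then obtain a b c a' b' c' where f: "f False = star_pattern a b c" "f True = star_pattern a' b' c'"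
    unfolding shifted_star_iff by blast
  have "shift a b c (f u) = (if u then star_pattern (a \<noteq> a') (b \<noteq> b') (c \<noteq> c') else star_pattern False False False)" for u
    by (cases u) (simp_all add: f star_pattern_def shift_shift)
  then show thesis using that unfolding shift_def by blast
qed

lemma facet_weight_le: "facet_weight p \<le> 48"
proof -
  consider "star_count (\<lambda>b x y z. p x y z b) = 2" | "star_count (\<lambda>b x y z. p x y b z) = 2"
    | "star_count (\<lambda>b x y z. p x b y z) = 2" | "star_count (\<lambda>b x y z. p b x y z) = 2"
    | "facet_weight p \<le> 48"
    using facet_weight_le_no_opposite by blast
  then show ?thesis
  proof cases
    case 1
    then obtain a b c a' b' c' where "\<And>u. (\<lambda>x y z. p (x \<noteq> a) (y \<noteq> b) (z \<noteq> c) u) =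
        (if u then star_pattern a' b' c' else star_pattern False False False)"
      using star_count_2E by blast
    from facet_weight_opposite(1)[of "\<lambda>u x y z. p (x \<noteq> a) (y \<noteq> b) (z \<noteq> c) u", OF this]
    show ?thesis using facet_weight_shift[of a b c False p] by (simp add: shift4_def)
  next
    case 2
    then obtain a b c a' b' c' where "\<And>u. (\<lambda>x y z. p (x \<noteq> a) (y \<noteq> b) u (z \<noteq> c)) =
        (if u then star_pattern a' b' c' else star_pattern False False False)"
      using star_count_2E by blast
    from facet_weight_opposite(2)[of "\<lambda>u x y z. p (x \<noteq> a) (y \<noteq> b) u (z \<noteq> c)", OF this]
    show ?thesis using facet_weight_shift[of a b False c p] by (simp add: shift4_def)
  next
    case 3
    then obtain a b c a' b' c' where "\<And>u. (\<lambda>x y z. p (x \<noteq> a) u (y \<noteq> b) (z \<noteq> c)) =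
        (if u then star_pattern a' b' c' else star_pattern False False False)"
      using star_count_2E by blast
    from facet_weight_opposite(3)[of "\<lambda>u x y z. p (x \<noteq> a) u (y \<noteq> b) (z \<noteq> c)", OF this]
    show ?thesis using facet_weight_shift[of a False b c p] by (simp add: shift4_def)
  next
    case 4
    then obtain a b c a' b' c' where "\<And>u. (\<lambda>x y z. p u (x \<noteq> a) (y \<noteq> b) (z \<noteq> c)) =
        (if u then star_pattern a' b' c' else star_pattern False False False)"
      using star_count_2E by blast
    from facet_weight_opposite(4)[of "\<lambda>u x y z. p u (x \<noteq> a) (y \<noteq> b) (z \<noteq> c)", OF this]
    show ?thesis using facet_weight_shift[of False a b c p] by (simp add: shift4_def)
  qed
qed

text \<open>All facets contribute equally, and so do all shifts and all pairs of directions: 72 is 9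
  times 8 facets, and 96 is 6 pairs times 16 shifts.\<close>

lemma pattern_sum_facet_weight:
  "pattern_sum n S facet_weight = 72 * pattern_sum n S (\<lambda>p. of_bool (shifted_star (\<lambda>x y z. p x y z False)))
    + 96 * pattern_sum n S facet_product"
proof -
  have fp: "pattern_sum n S facet_products = 16 * pattern_sum n S facet_product"
    by (simp add: facet_products_def[abs_def] pattern_sum_sum pattern_sum_shift4)
  have 1: "pattern_sum n S (\<lambda>p. h (\<lambda>x y z u. p x z u y)) = pattern_sum n S h" for h
    using pattern_sum_swap(3)[of n S "\<lambda>p. h (\<lambda>x y z u. p x z y u)"] pattern_sum_swap(2)[of n S h] by simp
  have 2: "pattern_sum n S (\<lambda>p. h (\<lambda>x y z u. p z x y u)) = pattern_sum n S h" for h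
    using pattern_sum_swap(1)[of n S "\<lambda>p. h (\<lambda>x y z u. p x z y u)"] pattern_sum_swap(2)[of n S h] by simp
  have 3: "pattern_sum n S (\<lambda>p. h (\<lambda>x y z u. p z x u y)) = pattern_sum n S h" for h
    using pattern_sum_swap(3)[of n S "\<lambda>p. h (\<lambda>x y z u. p z x y u)"] 2[of h] by simp
  have 4: "pattern_sum n S (\<lambda>p. h (\<lambda>x y z u. p z u x y)) = pattern_sum n S h" for h
    using pattern_sum_swap(2)[of n S "\<lambda>p. h (\<lambda>x y z u. p z x u y)"] 3[of h] by simp
  define G where "G = pattern_sum n S (\<lambda>p. of_bool (shifted_star (\<lambda>x y z. p x y z False)))"
  note facets = pattern_sum_facets[of n S "\<lambda>q. of_bool (shifted_star q)", folded G_def]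
  have "pattern_sum n S star_facets = 8 * G"
    unfolding star_facets_def[abs_def] star_count_def pattern_sum_add pattern_sum_sum facets by simp
  then show ?thesis
    unfolding facet_weight_def[abs_def] pattern_sum_add pattern_sum_cmult
      pattern_sum_swap(2)[of n S facet_products] 1[of facet_products] 2[of facet_products] 3[of facet_products]
      4[of facet_products] fp G_def[symmetric]
    by simp
qed

lemma W_subset_cube: "W7 \<subseteq> cube 3" "W8 \<subseteq> cube 3" "W9 \<subseteq> cube 3" "W10 \<subseteq> cube 3" "W12 \<subseteq> cube 3"
  by (simp_all add: W7_def W8_def W9_def W10_def W12_def)

lemma Lambda_set_W8_le:
  assumes "n > 0"
  shows "3 * (48 * int (Lambda_set 3 W8 n S)) \<le> 2 * (2 ^ n * int n ^ 3)"
proof (rule Lambda_set_le[OF W_subset_cube(2) assms])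
  have "pattern_sum n S facet_weight \<le> pattern_sum n S (\<lambda>p. 48)"
    by (rule pattern_sum_mono) (rule facet_weight_le)
  moreover have "0 \<le> pattern_sum n S facet_product"
    unfolding facet_product_def[abs_def] by (rule pattern_sum_square_nonneg)
  ultimately show "3 * pattern_sum n S (\<lambda>p. of_bool (iso_pattern W8 (\<lambda>x y z. p x y z False))) \<le> 2 * (2 ^ n * int n ^ 4)"
    unfolding pattern_sum_facet_weight pattern_sum_const iso_pattern_W8 by simp
qed simp

section \<open>The upper bounds for W7, W9, W10 and W12\<close>

text \<open>Whatever holds for the 48 images of \<open>H\<close> under automorphisms holds for all
  copies; this shows that copies have the invariants below.\<close>

lemma iso_patternE:
  assumes iso: "iso_pattern H q"
    and K: "\<And>a b c. let s = shift a b c (\<lambda>x y z. [x, y, z] \<in> H) in K s \<and> K (\<lambda>x y z. s x z y) \<and>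
      K (\<lambda>x y z. s y x z) \<and> K (\<lambda>x y z. s y z x) \<and> K (\<lambda>x y z. s z x y) \<and> K (\<lambda>x y z. s z y x)"
  shows "K q"
proof -
  have m: "\<exists>a b c. r = shift a b c (\<lambda>x y z. [x, y, z] \<in> H)" if "matches H r" for r
  proof -
    obtain a b c where "shift a b c r = (\<lambda>x y z. [x, y, z] \<in> H)"
      using \<open>matches H r\<close> unfolding matches_def shift_def by blast
    moreover have "shift a b c (shift a b c r) = r" by (simp add: shift_shift) (simp add: shift_def)
    ultimately show ?thesis by metis
  qed
  have K': "K r" "K (\<lambda>x y z. r x z y)" "K (\<lambda>x y z. r y x z)" "K (\<lambda>x y z. r y z x)" "K (\<lambda>x y z. r z x y)"
    "K (\<lambda>x y z. r z y x)" if "matches H r" for r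
    using m[OF that] K unfolding Let_def by blast+
  consider "matches H q" | "matches H (\<lambda>x y z. q x z y)" | "matches H (\<lambda>x y z. q y x z)"
    | "matches H (\<lambda>x y z. q y z x)" | "matches H (\<lambda>x y z. q z x y)" | "matches H (\<lambda>x y z. q z y x)"
    using iso unfolding iso_pattern_def by blast
  then show ?thesis
    by cases (use K' in fastforce)+
qed

section \<open>Invariants that single out the isomorphism classes\<close>

definition size3 :: "pattern3 \<Rightarrow> int" where
  "size3 q = (\<Sum>x\<in>UNIV. \<Sum>y\<in>UNIV. \<Sum>z\<in>UNIV. of_bool (q x y z))"

definition antipodal :: "pattern3 \<Rightarrow> bool" where
  "antipodal q \<longleftrightarrow> (\<exists>x y z. q x y z \<and> q (\<not> x) (\<not> y) (\<not> z))"

definition claw :: "pattern3 \<Rightarrow> bool" where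
  "claw q \<longleftrightarrow> (\<exists>x y z. q x y z \<and> q (\<not> x) y z \<and> q x (\<not> y) z \<and> q x y (\<not> z))"

definition cherry_antipode :: "pattern3 \<Rightarrow> bool" where
  "cherry_antipode q \<longleftrightarrow> (\<exists>x y z. q x y z \<and> q (\<not> x) (\<not> y) (\<not> z) \<and>
     (q (\<not> x) y z \<and> q x (\<not> y) z \<or> q (\<not> x) y z \<and> q x y (\<not> z) \<or> q x (\<not> y) z \<and> q x y (\<not> z)))"

lemmas bool_unfold = size3_def antipodal_def claw_def cherry_antipode_def iso_pattern_def matches_def
  sum_bool shift_def ex_bool_eq all_bool_eq oct_simps noteq_bool

lemma iso_pattern_W7: "iso_pattern W7 q \<longleftrightarrow> size3 q = 2 \<and> antipodal q"
proof
  assume "iso_pattern W7 q"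
  then show "size3 q = 2 \<and> antipodal q"
    apply (rule iso_patternE)
    subgoal for a b c by (cases a; cases b; cases c; simp add: Let_def bool_unfold W7_def)
    done
next
  show "size3 q = 2 \<and> antipodal q \<Longrightarrow> iso_pattern W7 q"
  proof (induction q rule: pattern3_cases)
    case (1 b0 b1 b2 b3 b4 b5 b6 b7)
    then show ?case
      \<comment> \<open>Most colourings violate the premise; only the few remaining ones need a
        witness among the automorphisms.\<close>
      by (cases b0; cases b1; cases b2; cases b3; cases b4; cases b5; cases b6; cases b7;
        (simp add: size3_def antipodal_def sum_bool ex_bool_eq oct_simps; fail)?; simp add: bool_unfold W7_def)
  qed
qed

lemma iso_pattern_W9: "iso_pattern W9 q \<longleftrightarrow> size3 q = 4 \<and> cherry_antipode q"
proof
  assume "iso_pattern W9 q"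
  then show "size3 q = 4 \<and> cherry_antipode q"
    apply (rule iso_patternE)
    subgoal for a b c by (cases a; cases b; cases c; simp add: Let_def bool_unfold W9_def)
    done
next
  show "size3 q = 4 \<and> cherry_antipode q \<Longrightarrow> iso_pattern W9 q"
  proof (induction q rule: pattern3_cases)
    case (1 b0 b1 b2 b3 b4 b5 b6 b7)
    then show ?case
      by (cases b0; cases b1; cases b2; cases b3; cases b4; cases b5; cases b6; cases b7;
        (simp add: size3_def cherry_antipode_def sum_bool ex_bool_eq oct_simps; fail)?; simp add: bool_unfold W9_def)
  qed
qed

text \<open>Every vertex outside an antipodal pair is adjacent to exactly one of its two members, so
  all triples containing such a pair are equivalent.\<close>

lemma iso_pattern_W10: "iso_pattern W10 q \<longleftrightarrow> size3 q = 3 \<and> antipodal q"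
proof
  assume "iso_pattern W10 q"
  then show "size3 q = 3 \<and> antipodal q"
    apply (rule iso_patternE)
    subgoal for a b c by (cases a; cases b; cases c; simp add: Let_def bool_unfold W10_def)
    done
next
  show "size3 q = 3 \<and> antipodal q \<Longrightarrow> iso_pattern W10 q"
  proof (induction q rule: pattern3_cases)
    case (1 b0 b1 b2 b3 b4 b5 b6 b7)
    then show ?case
      by (cases b0; cases b1; cases b2; cases b3; cases b4; cases b5; cases b6; cases b7;
        (simp add: size3_def antipodal_def sum_bool ex_bool_eq oct_simps; fail)?; simp add: bool_unfold W10_def)
  qed
qed

lemma iso_pattern_W12: "iso_pattern W12 q \<longleftrightarrow> size3 q = 4 \<and> claw q"
proof
  assume "iso_pattern W12 q"
  then show "size3 q = 4 \<and> claw q"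
    apply (rule iso_patternE)
    subgoal for a b c by (cases a; cases b; cases c; simp add: Let_def bool_unfold W12_def)
    done
next
  show "size3 q = 4 \<and> claw q \<Longrightarrow> iso_pattern W12 q"
  proof (induction q rule: pattern3_cases)
    case (1 b0 b1 b2 b3 b4 b5 b6 b7)
    then show ?case
      by (cases b0; cases b1; cases b2; cases b3; cases b4; cases b5; cases b6; cases b7;
        (simp add: size3_def claw_def sum_bool ex_bool_eq oct_simps; fail)?; simp add: bool_unfold W12_def)
  qed
qed

text \<open>
  The squares are integer roundings of numerical solutions of the semidefinite program dual to the extremal problem;
  each form vanishes on the extremal colouring.
\<close>

definition certificate_W7 :: "(int \<times> edge_form) list" where
  "certificate_W7 = [(1, False, False, 0, 1, -1, 0)]"

text \<open>The form compares the numbers of coloured neighbours of the two ends of an uncoloured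
  edge. Its symmetrized square is -12 on W7 and 6 on W8, the two types occurring in the modulo 3
  colouring. Equality on both needs 18 - 12 = 6.\<close>

lemma certificate_W7_le:
  "18 * of_bool (iso_pattern W7 q) + symmetrized (certificate certificate_W7) q \<le> 6"
  unfolding iso_pattern_W7
proof (induction q rule: pattern3_cases)
  case (1 b0 b1 b2 b3 b4 b5 b6 b7)
  show ?case
    by (simp only: symmetrized_def certificate_def bool_unfold simp_thms,
      cases b0; cases b1; cases b2; cases b3; cases b4; cases b5; cases b6; cases b7;
      simp add: edge_kernel_def certificate_W7_def)
qed

lemma Lambda_set_W7_le:
  assumes "n > 0"
  shows "18 * (48 * int (Lambda_set 3 W7 n S)) \<le> 6 * (2 ^ n * int n ^ 3)"
  by (rule Lambda_set_le_certificate[OF _ assms _ _ certificate_W7_le])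
    (simp_all add: W_subset_cube certificate_W7_def)

text \<open>At a typical vertex of the extremal colouring a direction changes the residue modulo 4
  by +1, -1 or 2, each with share 1/3. On every edge to which a form applies, its three
  corresponding coefficients sum to 0.\<close>

definition certificate_W9 :: "(int \<times> edge_form) list" where
  "certificate_W9 = [(2, False, False, 1, 1, 1, -2),
    (4, True, False, 0, 2, -1, 1), (4, True, False, 1, 0, 0, -1),
    (5, True, True, 0, 1, -1, 0), (5, True, True, 2, -1, -1, 0)]"

lemma certificate_W9_le:
  "108 * of_bool (iso_pattern W9 q) + symmetrized (certificate certificate_W9) q \<le> 48"
  unfolding iso_pattern_W9
proof (induction q rule: pattern3_cases)
  case (1 b0 b1 b2 b3 b4 b5 b6 b7)
  show ?case
    by (simp only: symmetrized_def certificate_def bool_unfold simp_thms,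
      cases b0; cases b1; cases b2; cases b3; cases b4; cases b5; cases b6; cases b7;
      simp add: edge_kernel_def certificate_W9_def)
qed

lemma Lambda_set_W9_le:
  assumes "n > 0"
  shows "108 * (48 * int (Lambda_set 3 W9 n S)) \<le> 48 * (2 ^ n * int n ^ 3)"
  by (rule Lambda_set_le_certificate[OF _ assms _ _ certificate_W9_le])
    (simp_all add: W_subset_cube certificate_W9_def)

definition certificate_W10 :: "(int \<times> edge_form) list" where
  "certificate_W10 = [(30, False, False, 0, 1, 0, -2), (40, False, False, 0, 3, -2, -2),
    (2, False, False, 5, 3, -4, -3), (95, True, False, 1, -2, 0, 0),
    (25, True, False, 3, 0, -2, -2), (2, True, True, 1, 0, 0, -5)]"

lemma certificate_W10_le:
  "2880 * of_bool (iso_pattern W10 q) + symmetrized (certificate certificate_W10) q \<le> 1200"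
  unfolding iso_pattern_W10
proof (induction q rule: pattern3_cases)
  case (1 b0 b1 b2 b3 b4 b5 b6 b7)
  show ?case
    by (simp only: symmetrized_def certificate_def bool_unfold simp_thms,
      cases b0; cases b1; cases b2; cases b3; cases b4; cases b5; cases b6; cases b7;
      simp add: edge_kernel_def certificate_W10_def)
qed

lemma Lambda_set_W10_le:
  assumes "n > 0"
  shows "2880 * (48 * int (Lambda_set 3 W10 n S)) \<le> 1200 * (2 ^ n * int n ^ 3)"
  by (rule Lambda_set_le_certificate[OF _ assms _ _ certificate_W10_le])
    (simp_all add: W_subset_cube certificate_W10_def)

text \<open>In the modulo 4 colouring an edge with differently coloured ends has monochromatic
  parallel edges, of both colours equally often at a typical vertex. The symmetrized square is -6 on
  W12 and 6 on the other types of that colouring, hence the multiplier 12 and the bound 6.\<close>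

definition certificate_W12 :: "(int \<times> edge_form) list" where
  "certificate_W12 = [(1, True, False, 1, 0, 0, -1)]"

lemma certificate_W12_le:
  "12 * of_bool (iso_pattern W12 q) + symmetrized (certificate certificate_W12) q \<le> 6"
  unfolding iso_pattern_W12
proof (induction q rule: pattern3_cases)
  case (1 b0 b1 b2 b3 b4 b5 b6 b7)
  show ?case
    by (simp only: symmetrized_def certificate_def bool_unfold simp_thms,
      cases b0; cases b1; cases b2; cases b3; cases b4; cases b5; cases b6; cases b7;
      simp add: edge_kernel_def certificate_W12_def)
qed

lemma Lambda_set_W12_le:
  assumes "n > 0"
  shows "12 * (48 * int (Lambda_set 3 W12 n S)) \<le> 6 * (2 ^ n * int n ^ 3)"
  by (rule Lambda_set_le_certificate[OF _ assms _ _ certificate_W12_le])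
    (simp_all add: W_subset_cube certificate_W12_def)

section \<open>Lower bounds\<close>

text \<open>One commuting step per coordinate equal to 1. Varying the starting state
  \<open>s\<close> produces the translates of a colouring.\<close>

primrec run :: "(nat \<Rightarrow> 's \<Rightarrow> 's) \<Rightarrow> nat \<Rightarrow> bool list \<Rightarrow> 's \<Rightarrow> 's" where
  "run st i [] s = s"
| "run st i (b # bs) s = (if b then st i (run st (Suc i) bs s) else run st (Suc i) bs s)"

definition step_if :: "(nat \<Rightarrow> 's \<Rightarrow> 's) \<Rightarrow> bool \<Rightarrow> nat \<Rightarrow> 's \<Rightarrow> 's" where
  "step_if st b i s = (if b then st i s else s)"

lemma run_update:
  assumes "\<And>i j s. st i (st j s) = st j (st i s)" "j < length bs" "\<not> bs ! j"
  shows "run st i (bs[j := True]) s = st (i + j) (run st i bs s)"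
  using assms(2,3)
proof (induction bs arbitrary: i j)
  case (Cons b bs)
  then show ?case
  proof (cases j)
    case (Suc j')
    then have "run st (Suc i) (bs[j' := True]) s = st (Suc i + j') (run st (Suc i) bs s)"
      using Cons by simp
    then show ?thesis using Suc assms(1) by simp
  qed simp
qed simp

lemma run_flip_if:
  assumes "\<And>i j s. st i (st j s) = st j (st i s)" "j < length bs" "\<not> bs ! j"
  shows "run st 0 (flip_if b j bs) s = step_if st b j (run st 0 bs s)"
  using run_update[of st, OF assms, of 0 s] assms(3) by (simp add: flip_if_def step_if_def flip_def)

lemma bij_betw_run:
  assumes "\<And>i. bij_betw (st i) T T"
  shows "bij_betw (run st i bs) T T"
proof (induction bs arbitrary: i)
  case Nil
  have "run st i [] = (\<lambda>s. s)" by (simp add: fun_eq_iff)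
  then show ?case by (simp add: bij_betw_def)
next
  case (Cons b bs)
  show ?case
  proof (cases b)
    case True
    then have "run st i (b # bs) = st i \<circ> run st (Suc i) bs" by (simp add: fun_eq_iff)
    then show ?thesis using bij_betw_trans[OF Cons assms] by (simp only:)
  next
    case False
    then have "run st i (b # bs) = run st (Suc i) bs" by (simp add: fun_eq_iff)
    then show ?thesis using Cons by (simp only:)
  qed
qed

lemma card_bij_betw_preimage:
  assumes "bij_betw f T T"
  shows "card {t \<in> T. Q (f t)} = card {s \<in> T. Q s}"
proof (rule bij_betw_same_card)
  show "bij_betw f {t \<in> T. Q (f t)} {s \<in> T. Q s}"
    using assms by (auto simp: bij_betw_def inj_on_def image_iff)
qed

section \<open>Averaging over the translates of a colouring\<close>

lemma finite_Lambda_sets: "finite {Lambda_set d H n S | S. S \<subseteq> cube n}"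
proof -
  have "{Lambda_set d H n S | S. S \<subseteq> cube n} = Lambda_set d H n ` Pow (cube n)" by auto
  then show ?thesis by simp
qed

lemma Lambda_set_le_max: "S \<subseteq> cube n \<Longrightarrow> Lambda_set d H n S \<le> Lambda_max d H n"
  unfolding Lambda_max_def by (rule Max_ge[OF finite_Lambda_sets]) auto

lemma Lambda_max_attained: obtains S where "S \<subseteq> cube n" "Lambda_max d H n = Lambda_set d H n S"
proof -
  have "Lambda_max d H n \<in> {Lambda_set d H n S | S. S \<subseteq> cube n}"
    unfolding Lambda_max_def by (rule Max_in[OF finite_Lambda_sets]) auto
  then show thesis using that by auto
qed

text \<open>The state at a fixed vertex runs through \<open>T\<close> bijectively with the starting
  state. Hence each face sees every root state exactly once, and no equidistribution estimate is
  needed.\<close>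

lemma Lambda_max_ge_average:
  fixes st :: "nat \<Rightarrow> 's \<Rightarrow> 's"
  assumes H: "H \<subseteq> cube 3" and T: "finite T"
    and comm: "\<And>i j s. st i (st j s) = st j (st i s)" and bij: "\<And>i. bij_betw (st i) T T"
    and D: "D \<subseteq> {(i, j, k). i < n \<and> j < n \<and> k < n \<and> distinct [i, j, k]}"
    and count: "\<And>i j k. (i, j, k) \<in> D \<Longrightarrow>
      r \<le> card {s \<in> T. iso_pattern H (\<lambda>x y z. F (step_if st x i (step_if st y j (step_if st z k s))))}"
  shows "r * 2 ^ n * card D \<le> 48 * card T * Lambda_max 3 H n"
proof -
  define S where "S t = {v \<in> cube n. F (run st 0 v t)}" for t
  define P where "P t = (\<lambda>(v, i, j, k). gives_copy 3 H (S t) (face n {i, j, k} v))" for t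
  have finD: "finite D"
    by (rule finite_subset[OF D], rule finite_subset[of _ "{..<n} \<times> {..<n} \<times> {..<n}"]) auto
  have r: "r \<le> card {t \<in> T. P t (v, d)}" if v: "v \<in> cube n" and d: "d \<in> D" for v d
  proof -
    obtain i j k where ijk: "d = (i, j, k)" "i < n" "j < n" "k < n" "distinct [i, j, k]" "(i, j, k) \<in> D"
      using d D by auto
    \<comment> \<open>Steps need not be involutions, so the root is moved to the corner where all
      three coordinates are 0 and a flip is a forward step.\<close>
    define w where "w = v[i := False, j := False, k := False]"
    have w: "w \<in> cube n" "\<not> w ! i" "\<not> w ! j" "\<not> w ! k"
      using v ijk by (auto simp: w_def cube_def nth_list_update)
    have "w \<in> face n {i, j, k} v" using v ijk by (auto simp: w_def face_def cube_def nth_list_update)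
    then have face: "face n {i, j, k} v = face n {i, j, k} w"
      using v w ijk by (subst face_eq_iff) auto
    have pat: "pattern (S t) w i j k = (\<lambda>x y z. F (step_if st x i (step_if st y j (step_if st z k (run st 0 w t)))))" for t
    proof (intro ext)
      fix x y z
      have len: "length w = n" using w by (simp add: cube_def)
      have "run st 0 (flip_if x i (flip_if y j (flip_if z k w))) t =
          step_if st x i (step_if st y j (step_if st z k (run st 0 w t)))"
        using w ijk len by (simp add: run_flip_if[of st, OF comm] nth_flip_if)
      then show "pattern (S t) w i j k x y z =
          F (step_if st x i (step_if st y j (step_if st z k (run st 0 w t))))"
        using w by (simp add: pattern_def S_def)
    qed
    have "{t \<in> T. P t (v, d)} = {t \<in> T. iso_pattern H (\<lambda>x y z. F (step_if st x i (step_if st y j (step_if st z k (run st 0 w t)))))}"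
      by (simp add: P_def ijk(1) face gives_copy_iff[OF w(1) ijk(2-5) H] pat)
    also have "card \<dots> = card {s \<in> T. iso_pattern H (\<lambda>x y z. F (step_if st x i (step_if st y j (step_if st z k s))))}"
      by (rule card_bij_betw_preimage[OF bij_betw_run[of st, OF bij],
            of "\<lambda>s. iso_pattern H (\<lambda>x y z. F (step_if st x i (step_if st y j (step_if st z k s))))"])
    finally show ?thesis using count[OF ijk(6)] by simp
  qed
  have "r * 2 ^ n * card D = (\<Sum>e\<in>cube n \<times> D. r)"
    by (simp add: card_cartesian_product card_cube)
  also have "\<dots> \<le> (\<Sum>e\<in>cube n \<times> D. card {t \<in> T. P t e})"
    by (rule sum_mono) (auto intro: r)
  also have "\<dots> = (\<Sum>e\<in>cube n \<times> D. \<Sum>t\<in>T. of_bool (P t e))"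
    using T by (simp add: of_bool_def sum.If_cases Int_def)
  also have "\<dots> = (\<Sum>t\<in>T. \<Sum>e\<in>cube n \<times> D. of_bool (P t e))" by (rule sum.swap)
  also have "\<dots> = (\<Sum>t\<in>T. card {e \<in> cube n \<times> D. P t e})"
    using finD by (simp add: of_bool_def sum.If_cases Int_def)
  also have "\<dots> \<le> (\<Sum>t\<in>T. 48 * Lambda_max 3 H n)"
  proof (rule sum_mono)
    fix t
    have "card {e \<in> cube n \<times> D. P t e} \<le> card {(v, i, j, k) \<in> triples n. gives_copy 3 H (S t) (face n {i, j, k} v)}"
      using D by (intro card_mono finite_subset[OF _ finite_triples[of n]]) (auto simp: triples_def P_def)
    also have "\<dots> = 48 * Lambda_set 3 H n (S t)" by (rule card_copies)
    also have "\<dots> \<le> 48 * Lambda_max 3 H n" using Lambda_set_le_max[of "S t" n 3 H] by (auto simp: S_def)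
    finally show "card {e \<in> cube n \<times> D. P t e} \<le> 48 * Lambda_max 3 H n" .
  qed
  finally show ?thesis by simp
qed

lemma card_distinct_triples:
  "card {(i, j, k). i < m \<and> j < m \<and> k < m \<and> distinct [i, j, k]} = m * ((m - 1) * (m - 2))" for m :: nat
proof -
  have "{(i, j, k). i < m \<and> j < m \<and> k < m \<and> distinct [i, j, k]} =
      (SIGMA i:{..<m}. SIGMA j:{..<m} - {i}. {..<m} - {i, j})" by auto
  moreover have "card ({..<m} - {i, j}) = m - 2" if "i < m" "j \<in> {..<m} - {i}" for i j
    using that by (subst card_Diff_subset) auto
  then have "card (SIGMA j:{..<m} - {i}. {..<m} - {i, j}) = (m - 1) * (m - 2)" if "i < m" for i
    using that by (subst card_SigmaI) auto
  ultimately show ?thesis by (simp add: card_SigmaI numeral_2_eq_2)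
qed

lemma Lambda_max_ge_periodic:
  fixes \<sigma> :: "nat \<Rightarrow> 's \<Rightarrow> 's"
  assumes H: "H \<subseteq> cube 3" and T: "finite T" and A: "A \<subseteq> {..<M} \<times> {..<M} \<times> {..<M}"
    and comm: "\<And>i j s. \<sigma> i (\<sigma> j s) = \<sigma> j (\<sigma> i s)" and bij: "\<And>i. bij_betw (\<sigma> i) T T"
    and count: "\<And>a b c. (a, b, c) \<in> A \<Longrightarrow>
      r \<le> card {s \<in> T. iso_pattern H (\<lambda>x y z. F (step_if \<sigma> x a (step_if \<sigma> y b (step_if \<sigma> z c s))))}"
    and m: "m = n div M"
  shows "r * 2 ^ n * (card A * (m * ((m - 1) * (m - 2)))) \<le> 48 * card T * Lambda_max 3 H n"
proof -
  define Q where "Q = {(i, j, k). i < m \<and> j < m \<and> k < m \<and> distinct [i, j, k]}"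
  \<comment> \<open>Coordinates are cut into blocks of length \<open>M\<close>, the weight depending
    on the position inside the block. Distinct block numbers make the directions distinct even if
    positions repeat; the omitted triples are of lower order.\<close>
  define e where "e = (\<lambda>((a, b, c), (i, j, k)). (M * i + a, M * j + b, M * k + c))"
  have step: "step_if (\<lambda>i. \<sigma> (i mod M)) x i s = step_if \<sigma> x (i mod M) s" for x i s
    by (simp add: step_if_def)
  have lt: "M * i + a < n" if "i < m" "a < M" for i a
  proof -
    have "M * i + a < M * Suc i" using that by simp
    also have "\<dots> \<le> M * m" using that by (intro mult_le_mono2) simp
    also have "\<dots> \<le> n" by (simp add: m)
    finally show ?thesis .
  qed
  have eq: "M * i + a = M * i' + a' \<longleftrightarrow> i = i' \<and> a = a'" if "a < M" "a' < M" for i a i' a'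
  proof
    assume "M * i + a = M * i' + a'"
    then have "(M * i + a) div M = (M * i' + a') div M" "(M * i + a) mod M = (M * i' + a') mod M" by simp_all
    then show "i = i' \<and> a = a'" using that by simp
  qed simp
  have AM: "a < M \<and> b < M \<and> c < M" if "(a, b, c) \<in> A" for a b c using A that by auto
  have "inj_on e (A \<times> Q)"
  proof (rule inj_onI)
    fix t t' assume "t \<in> A \<times> Q" "t' \<in> A \<times> Q" and e: "e t = e t'"
    then obtain a b c i j k a' b' c' i' j' k' where
      t: "t = ((a, b, c), (i, j, k))" "t' = ((a', b', c'), (i', j', k'))" "(a, b, c) \<in> A" "(a', b', c') \<in> A"
      by auto
    show "t = t'" using e AM[OF t(3)] AM[OF t(4)] by (simp add: t e_def eq)
  qed
  then have "card (e ` (A \<times> Q)) = card A * (m * ((m - 1) * (m - 2)))"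
    by (simp add: card_image card_cartesian_product Q_def card_distinct_triples[simplified])
  moreover have "r * 2 ^ n * card (e ` (A \<times> Q)) \<le> 48 * card T * Lambda_max 3 H n"
  proof (rule Lambda_max_ge_average[OF H T, where st = "\<lambda>i. \<sigma> (i mod M)" and F = F])
    show "e ` (A \<times> Q) \<subseteq> {(i, j, k). i < n \<and> j < n \<and> k < n \<and> distinct [i, j, k]}"
      using A by (auto simp: e_def Q_def lt eq dest!: subsetD)
    fix i j k assume "(i, j, k) \<in> e ` (A \<times> Q)"
    then obtain a b c where "(a, b, c) \<in> A" "i mod M = a" "j mod M = b" "k mod M = c"
      using A by (auto simp: e_def dest!: subsetD)
    then show "r \<le> card {s \<in> T. iso_pattern H (\<lambda>x y z. F (step_if (\<lambda>i. \<sigma> (i mod M)) x i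
        (step_if (\<lambda>i. \<sigma> (i mod M)) y j (step_if (\<lambda>i. \<sigma> (i mod M)) z k s))))}"
      using count[of a b c] by (simp add: step)
  qed (use comm bij in auto)
  ultimately show ?thesis by simp
qed

section \<open>Limits\<close>

lemma real_choose_3: "real (n choose 3) = real n * (real n - 1) * (real n - 2) / 6"
proof -
  have "real (n choose 3) = (\<Prod>i = 0..<3. real n - real i) / fact 3"
    by (simp add: binomial_gbinomial gbinomial_prod_rev)
  then show ?thesis by (simp add: numeral_3_eq_3 fact_numeral)
qed

text \<open>The number of 3-subcubes is the number of rooted ordered triples divided by 48, so this
  is the form in which both bounds arrive.\<close>

lemma ind_ratio_eq:
  assumes "n \<ge> 3"
  shows "ind_ratio 3 H n = 48 * real (Lambda_max 3 H n) / (2 ^ n * (real n * (real n - 1) * (real n - 2)))"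
proof -
  have "(2::real) ^ n = 2 ^ (n - 3) * 2 ^ 3" using assms by (simp only: power_add[symmetric] le_add_diff_inverse2)
  moreover have "x / (p / 6 * q) = 48 * x / (q * 2 ^ 3 * p)" for x p q :: real
    by (cases "p = 0"; cases "q = 0"; simp)
  ultimately show ?thesis by (simp only: ind_ratio_def real_choose_3)
qed

lemma ind_ratio_le:
  assumes le: "\<And>S. int N * (48 * int (Lambda_set 3 H n S)) \<le> int K * (2 ^ n * int n ^ 3)"
    and N: "N > 0" and n: "n \<ge> 3"
  shows "ind_ratio 3 H n \<le> real K / real N * (real n ^ 3 / (real n * (real n - 1) * (real n - 2)))"
proof -
  obtain S where S: "Lambda_max 3 H n = Lambda_set 3 H n S" using Lambda_max_attained by metis
  have "real_of_int (int N * (48 * int (Lambda_set 3 H n S))) \<le> real_of_int (int K * (2 ^ n * int n ^ 3))"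
    using le by (simp only: of_int_le_iff)
  then have "48 * real (Lambda_max 3 H n) \<le> real K / real N * (2 ^ n * real n ^ 3)"
    using N by (simp add: S field_simps)
  then have "ind_ratio 3 H n \<le> real K / real N * (2 ^ n * real n ^ 3) / (2 ^ n * (real n * (real n - 1) * (real n - 2)))"
    unfolding ind_ratio_eq[OF n] using n by (intro divide_right_mono) auto
  also have "\<dots> = real K / real N * (real n ^ 3 / (real n * (real n - 1) * (real n - 2)))" by simp
  finally show ?thesis .
qed

lemma ind_ratio_ge:
  assumes ge: "r * 2 ^ n * (d * (m * ((m - 1) * (m - 2)))) \<le> 48 * t * Lambda_max 3 H n"
    and t: "t > 0" and n: "n \<ge> 3" and m: "real m \<ge> y" and y: "y \<ge> 3"
  shows "real (r * d) / real t * (y * (y - 1) * (y - 2)) / (real n * (real n - 1) * (real n - 2)) \<le> ind_ratio 3 H n"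
proof -
  \<comment> \<open>Makes the truncated subtractions in \<open>m - 1\<close> and
    \<open>m - 2\<close> agree with real ones.\<close>
  have m3: "m \<ge> 3" using m y by linarith
  have "real (r * 2 ^ n * (d * (m * ((m - 1) * (m - 2))))) \<le> real (48 * t * Lambda_max 3 H n)"
    using ge by (simp only: of_nat_le_iff)
  moreover have "real (m - 1) = real m - 1" "real (m - 2) = real m - 2" using m3 by auto
  ultimately have "real (r * d) * 2 ^ n * (real m * (real m - 1) * (real m - 2)) \<le> real t * (48 * real (Lambda_max 3 H n))"
    by (simp add: mult_ac)
  moreover have "y * (y - 1) * (y - 2) \<le> real m * (real m - 1) * (real m - 2)"
    using m y by (intro mult_mono) auto
  then have "real (r * d) * 2 ^ n * (y * (y - 1) * (y - 2)) \<le> real (r * d) * 2 ^ n * (real m * (real m - 1) * (real m - 2))"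
    by (intro mult_left_mono) auto
  ultimately have "real (r * d) * 2 ^ n * (y * (y - 1) * (y - 2)) \<le> real t * (48 * real (Lambda_max 3 H n))"
    by linarith
  then have "real (r * d) / real t * (y * (y - 1) * (y - 2)) \<le> 48 * real (Lambda_max 3 H n) / 2 ^ n"
    using t by (simp add: field_simps)
  moreover have "0 < real n * (real n - 1) * (real n - 2)" using n by simp
  ultimately have "real (r * d) / real t * (y * (y - 1) * (y - 2)) / (real n * (real n - 1) * (real n - 2)) \<le>
      48 * real (Lambda_max 3 H n) / 2 ^ n / (real n * (real n - 1) * (real n - 2))"
    by (intro divide_right_mono) auto
  then show ?thesis unfolding ind_ratio_eq[OF n] by simp
qed

text \<open>In the limit, \<open>r / t\<close> is the guaranteed share of good roots and
  \<open>d / M ^ 3\<close> the share of the chosen residue triples of directions.\<close>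

lemma ind_ratio_tendsto:
  assumes up: "\<And>n S. n > 0 \<Longrightarrow> int N * (48 * int (Lambda_set 3 H n S)) \<le> int K * (2 ^ n * int n ^ 3)"
    and low: "\<And>n m. m = n div M \<Longrightarrow> r * 2 ^ n * (d * (m * ((m - 1) * (m - 2)))) \<le> 48 * t * Lambda_max 3 H n"
    and pos: "N > 0" "M > 0" "t > 0" and eq: "real (r * d) / (real t * real M ^ 3) = L" "real K / real N = L"
  shows "ind_ratio 3 H \<longlonglongrightarrow> L"
proof (rule tendsto_sandwich)
  let ?f = "\<lambda>n. real (r * d) / real t * ((real n / real M - 1) * (real n / real M - 1 - 1) * (real n / real M - 1 - 2))
    / (real n * (real n - 1) * (real n - 2))"
  let ?g = "\<lambda>n. real K / real N * (real n ^ 3 / (real n * (real n - 1) * (real n - 2)))"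
  have "?f n \<le> ind_ratio 3 H n" if n: "n \<ge> 4 * M + 3" for n
  proof (rule ind_ratio_ge[OF low[OF refl] pos(3)])
    have "real n = real M * real (n div M) + real (n mod M)"
      by (metis of_nat_add of_nat_mult mult_div_mod_eq)
    moreover have "real (n mod M) < real M" using pos by simp
    ultimately show "real n / real M - 1 \<le> real (n div M)" using pos by (simp add: field_simps)
    have "4 * real M \<le> real n" using n by linarith
    then show "3 \<le> real n / real M - 1" using pos by (simp add: field_simps)
  qed (use n in simp)
  then show "eventually (\<lambda>n. ?f n \<le> ind_ratio 3 H n) sequentially"
    by (rule eventually_sequentiallyI)
  have "ind_ratio 3 H n \<le> ?g n" if "n \<ge> 3" for n
    using that pos by (intro ind_ratio_le up) auto
  then show "eventually (\<lambda>n. ind_ratio 3 H n \<le> ?g n) sequentially"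
    by (rule eventually_sequentiallyI)
  have "(\<lambda>n. real n ^ 3 / (real n * (real n - 1) * (real n - 2))) \<longlonglongrightarrow> 1" by real_asymp
  from tendsto_mult_left[OF this, of "real K / real N"] show "?g \<longlonglongrightarrow> L"
    using eq by simp
  have "(\<lambda>n. (real n * c - 1) * (real n * c - 1 - 1) * (real n * c - 1 - 2)
      / (real n * (real n - 1) * (real n - 2))) \<longlonglongrightarrow> c * c * c" if "c > 0" for c :: real
    using that by real_asymp
  from this[of "1 / real M"] have "(\<lambda>n. (real n / real M - 1) * (real n / real M - 1 - 1) * (real n / real M - 1 - 2)
      / (real n * (real n - 1) * (real n - 2))) \<longlonglongrightarrow> 1 / real M ^ 3"
    using pos by (simp add: power3_eq_cube)
  from tendsto_mult_left[OF this, of "real (r * d) / real t"] show "?f \<longlonglongrightarrow> L"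
    using eq by simp
qed

lemma card_ge_subset:
  assumes "finite T" "B \<subseteq> T" "\<And>s. s \<in> B \<Longrightarrow> P s" "r \<le> card B"
  shows "r \<le> card {s \<in> T. P s}"
  using card_mono[of "{s \<in> T. P s}" B] assms by fastforce

section \<open>Colourings attaining the bounds\<close>

definition cyclic_step :: "nat \<Rightarrow> (nat \<Rightarrow> nat) \<Rightarrow> nat \<Rightarrow> nat \<Rightarrow> nat" where
  "cyclic_step m w i s = (s + w i) mod m"

definition xor_step :: "(nat \<Rightarrow> int) \<Rightarrow> nat \<Rightarrow> int \<Rightarrow> int" where
  "xor_step w i s = xor s (w i)"

lemma cyclic_step_commute: "cyclic_step m w i (cyclic_step m w j s) = cyclic_step m w j (cyclic_step m w i s)"
  by (simp add: cyclic_step_def mod_simps add_ac)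

lemma xor_step_commute: "xor_step w i (xor_step w j s) = xor_step w j (xor_step w i s)"
  by (simp add: xor_step_def xor.assoc xor.commute[of "w i"])

lemma bij_betw_cyclic_step:
  assumes "m > 0"
  shows "bij_betw (cyclic_step m w i) {..<m} {..<m}"
proof -
  define k where "k = m - w i mod m"
  have k: "(w i + k) mod m = 0"
    using assms mod_add_left_eq[of "w i" m k] by (simp add: k_def)
  have id: "(s + (w i + k)) mod m = s" if "s < m" for s
    using that mod_add_right_eq[of s "w i + k" m] k by simp
  show ?thesis
    using assms id
    by (intro bij_betw_byWitness[where f' = "\<lambda>s. (s + k) mod m"])
      (auto simp: cyclic_step_def mod_add_left_eq add.assoc add.commute[of k])
qed

lemma bij_betw_xor_step:
  assumes "0 \<le> w i" "w i < 2 ^ r"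
  shows "bij_betw (xor_step w i) {0..<2 ^ r} {0..<2 ^ r}"
proof -
  \<comment> \<open>Written as a fixed point of \<open>take_bit\<close>, the range is visibly closed
    under xor.\<close>
  have mem: "s \<in> {0..<2 ^ r} \<longleftrightarrow> take_bit r s = s" for s :: int
    by (simp add: take_bit_int_eq_self_iff)
  have "take_bit r (w i) = w i" using assms by (simp add: take_bit_int_eq_self_iff)
  then have "xor_step w i s \<in> {0..<2 ^ r}" if "s \<in> {0..<2 ^ r}" for s
    using that unfolding mem xor_step_def take_bit_xor by simp
  moreover have "xor_step w i (xor_step w i s) = s" for s by (simp add: xor_step_def xor.assoc)
  ultimately show ?thesis by (intro bij_betw_byWitness[where f' = "xor_step w i"]) auto
qed

lemmas pattern_eval = size3_def antipodal_def claw_def cherry_antipode_def shifted_star_def star_def shift_def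
  sum_bool ex_bool_eq step_if_def cyclic_step_def

text \<open>With all weights 1 the layers of a 3-cube have residues s, s+1, s+2, s+3, so its
  colouring depends on the root residue alone; \<open>B\<close> holds residues that yield
  copies.\<close>

lemma Lambda_max_ge_layered:
  assumes H: "H \<subseteq> cube 3" and M: "M > 0" and B: "B \<subseteq> {..<M}"
    and iso: "\<And>s. s \<in> B \<Longrightarrow> iso_pattern H (\<lambda>x y z. F (step_if (cyclic_step M (\<lambda>_. 1)) x 0
      (step_if (cyclic_step M (\<lambda>_. 1)) y 0 (step_if (cyclic_step M (\<lambda>_. 1)) z 0 s))))"
    and m: "m = n div 1" and r: "card B = r"
  shows "r * 2 ^ n * (1 * (m * ((m - 1) * (m - 2)))) \<le> 48 * M * Lambda_max 3 H n"
proof -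
  have "r \<le> card {s \<in> {..<M}. iso_pattern H (\<lambda>x y z. F (step_if (cyclic_step M (\<lambda>_. 1)) x 0
      (step_if (cyclic_step M (\<lambda>_. 1)) y 0 (step_if (cyclic_step M (\<lambda>_. 1)) z 0 s))))}"
    by (rule card_ge_subset[OF _ B iso]) (use r in auto)
  then show ?thesis
    using Lambda_max_ge_periodic[where \<sigma> = "cyclic_step M (\<lambda>_. 1)" and T = "{..<M}" and A = "{(0, 0, 0)}" and M = 1
        and r = r and F = F and n = n and m = m, OF H _ _ cyclic_step_commute bij_betw_cyclic_step[OF M]] m
    by simp
qed

lemma Lambda_max_W7_ge:
  assumes "m = n div 1"
  shows "1 * 2 ^ n * (1 * (m * ((m - 1) * (m - 2)))) \<le> 48 * 3 * Lambda_max 3 W7 n"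
  by (rule Lambda_max_ge_layered[OF W_subset_cube(1) _ _ _ assms, where B = "{0}" and F = "\<lambda>s. s = 0"])
    (simp, simp, (elim insertE emptyE; simp add: iso_pattern_W7 pattern_eval), simp)

lemma Lambda_max_W8_ge:
  assumes "m = n div 1"
  shows "2 * 2 ^ n * (1 * (m * ((m - 1) * (m - 2)))) \<le> 48 * 3 * Lambda_max 3 W8 n"
  \<comment> \<open>Root residue 1 colours exactly layer 2, and root residue 2 exactly layer
    1.\<close>
  by (rule Lambda_max_ge_layered[OF W_subset_cube(2) _ _ _ assms, where B = "{1, 2}" and F = "\<lambda>s. s = 0"])
    (simp, simp, (elim insertE emptyE; simp add: iso_pattern_W8 pattern_eval), simp)

lemma Lambda_max_W12_ge:
  assumes "m = n div 1"
  shows "2 * 2 ^ n * (1 * (m * ((m - 1) * (m - 2)))) \<le> 48 * 4 * Lambda_max 3 W12 n"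
  \<comment> \<open>Root residue 0 colours layers 0 and 1, root residue 2 layers 2 and 3: claws at
    opposite corners.\<close>
  by (rule Lambda_max_ge_layered[OF W_subset_cube(5) _ _ _ assms, where B = "{0, 2}" and F = "\<lambda>s. s < 2"])
    (simp, simp, (elim insertE emptyE; simp add: iso_pattern_W12 pattern_eval), simp)

definition weight_W9 :: "nat \<Rightarrow> nat" where
  "weight_W9 i = (if i = 0 then 2 else 1)"

text \<open>Directions of weights 2, 1, 1 give a copy at all four roots. Of the 27 residue triples,
  3 * 2 * 2 = 12 have exactly one direction of weight 2.\<close>

lemma Lambda_max_W9_ge:
  assumes m: "m = n div 3"
  shows "4 * 2 ^ n * (12 * (m * ((m - 1) * (m - 2)))) \<le> 48 * 4 * Lambda_max 3 W9 n"
proof -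
  let ?st = "cyclic_step 4 weight_W9"
  define A :: "(nat \<times> nat \<times> nat) set" where
    "A = {0} \<times> {1, 2} \<times> {1, 2} \<union> {1, 2} \<times> {0} \<times> {1, 2} \<union> {1, 2} \<times> {1, 2} \<times> {0}"
  have "4 \<le> card {s \<in> {..<4}. iso_pattern W9 (\<lambda>x y z. step_if ?st x a (step_if ?st y b (step_if ?st z c s)) < 2)}"
    if "(a, b, c) \<in> A" for a b c
  proof (rule card_ge_subset[of _ "{0, 1, 2, 3}"])
    have "weight_W9 a = 2 \<and> weight_W9 b = 1 \<and> weight_W9 c = 1 \<or> weight_W9 a = 1 \<and> weight_W9 b = 2 \<and> weight_W9 c = 1 \<or>
        weight_W9 a = 1 \<and> weight_W9 b = 1 \<and> weight_W9 c = 2"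
      using that by (auto simp: A_def weight_W9_def)
    moreover fix s :: nat assume "s \<in> {0, 1, 2, 3}"
    then have "s = 0 \<or> s = 1 \<or> s = 2 \<or> s = 3" by simp
    ultimately show "iso_pattern W9 (\<lambda>x y z. step_if ?st x a (step_if ?st y b (step_if ?st z c s)) < 2)"
      unfolding iso_pattern_W9 by (elim disjE conjE; simp add: pattern_eval)
  qed auto
  moreover have "card A = 12"
    unfolding A_def by (subst card_Un_disjoint; (subst card_Un_disjoint)?; auto simp: card_cartesian_product)
  moreover have "A \<subseteq> {..<3} \<times> {..<3} \<times> {..<3}" by (auto simp: A_def)
  ultimately show ?thesis
    using Lambda_max_ge_periodic[where \<sigma> = ?st and T = "{..<4}" and A = A and M = 3 and r = 4 and F = "\<lambda>s. s < 2"
        and n = n and m = m, OF W_subset_cube(3) _ _ cyclic_step_commute bij_betw_cyclic_step] m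
    by simp
qed

text \<open>
  The five unit vectors of the xor group on {0..31} and their sum 31 generate a folded 6-cube. The code was found by
  computer search: for any three distinct generators, 24 of the 32 roots span a copy of W10.
\<close>

definition weight_W10 :: "nat \<Rightarrow> int" where
  "weight_W10 i = (if i = 0 then 1 else if i = 1 then 2 else if i = 2 then 4 else if i = 3 then 8
     else if i = 4 then 16 else 31)"

definition code_W10 :: "int \<Rightarrow> bool" where
  "code_W10 s \<longleftrightarrow> s \<in> {0, 2, 5, 11, 12, 15, 19, 21, 22, 24, 25, 30}"

definition copy_W10 :: "int \<Rightarrow> int \<Rightarrow> int \<Rightarrow> int \<Rightarrow> bool" where
  "copy_W10 u v w s \<longleftrightarrow> iso_pattern W10 (oct (code_W10 s) (code_W10 (xor s w)) (code_W10 (xor s v))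
    (code_W10 (xor (xor s w) v)) (code_W10 (xor s u)) (code_W10 (xor (xor s w) u)) (code_W10 (xor (xor s v) u))
    (code_W10 (xor (xor (xor s w) v) u)))"

text \<open>In the numbering of \<open>oct\<close> antipodal vertices have indices with sum
  7.\<close>

lemma iso_pattern_W10_oct: "iso_pattern W10 (oct b0 b1 b2 b3 b4 b5 b6 b7) \<longleftrightarrow>
    of_bool b0 + of_bool b1 + of_bool b2 + of_bool b3 + of_bool b4 + of_bool b5 + of_bool b6 + of_bool b7 = (3 :: int) \<and>
    (b0 \<and> b7 \<or> b1 \<and> b6 \<or> b2 \<and> b5 \<or> b3 \<and> b4)"
  unfolding iso_pattern_W10 size3_def antipodal_def sum_bool ex_bool_eq not_True_eq_False not_False_eq_True oct_simps
  by (cases b0; cases b1; cases b2; cases b3; simp)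

lemma iso_pattern_swap:
  "iso_pattern H (\<lambda>x y z. q y x z) = iso_pattern H q" "iso_pattern H (\<lambda>x y z. q x z y) = iso_pattern H q"
  unfolding iso_pattern_def by blast+

text \<open>These are the 20 unordered triples of the six generators; symmetry of
  \<open>copy_W10\<close> gives the other orderings.\<close>

lemma length_filter_copy_W10:
  "(u, v, w) \<in> {(1, 2, 4), (1, 2, 8), (1, 2, 16), (1, 2, 31), (1, 4, 8), (1, 4, 16), (1, 4, 31), (1, 8, 16), (1, 8, 31),
     (1, 16, 31), (2, 4, 8), (2, 4, 16), (2, 4, 31), (2, 8, 16), (2, 8, 31), (2, 16, 31), (4, 8, 16), (4, 8, 31),
     (4, 16, 31), (8, 16, 31)} \<Longrightarrow> length (filter (copy_W10 u v w) [0..31]) = 24"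
  by (elim insertE emptyE; simp add: upto.simps copy_W10_def iso_pattern_W10_oct code_W10_def)

lemma copy_W10_swap: "copy_W10 v u w = copy_W10 u v w" "copy_W10 u w v = copy_W10 u v w"
proof -
  have oct_swap: "oct b0 b1 b4 b5 b2 b3 b6 b7 = (\<lambda>x y z. oct b0 b1 b2 b3 b4 b5 b6 b7 y x z)"
    "oct b0 b2 b1 b3 b4 b6 b5 b7 = (\<lambda>x y z. oct b0 b1 b2 b3 b4 b5 b6 b7 x z y)" for b0 b1 b2 b3 b4 b5 b6 b7
    by (simp_all add: oct_def fun_eq_iff)
  have xor_swap: "xor (xor s a) b = xor (xor s b) a" for s a b :: int
    by (simp add: xor.assoc xor.commute[of a])
  have "copy_W10 v u w s = copy_W10 u v w s" for s
    unfolding copy_W10_def by (subst iso_pattern_swap(1)[symmetric], subst oct_swap(1)[symmetric]) (simp only: xor_swap[of _ v u])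
  then show "copy_W10 v u w = copy_W10 u v w" by (rule ext)
  have "copy_W10 u w v s = copy_W10 u v w s" for s
    unfolding copy_W10_def by (subst iso_pattern_swap(2)[symmetric], subst oct_swap(2)[symmetric]) (simp only: xor_swap[of _ w v])
  then show "copy_W10 u w v = copy_W10 u v w" by (rule ext)
qed

lemma length_filter_weight_W10:
  assumes "a < 6" "b < 6" "c < 6" "distinct [a, b, c]"
  shows "length (filter (copy_W10 (weight_W10 a) (weight_W10 b) (weight_W10 c)) [0..31]) = 24"
proof -
  define L where "L a b c = length (filter (copy_W10 (weight_W10 a) (weight_W10 b) (weight_W10 c)) [0..31])" for a b c
  have swap: "L b a c = L a b c" "L a c b = L a b c" for a b c
    unfolding L_def by (intro arg_cong[where f = "\<lambda>P. length (filter P [0..31])"] copy_W10_swap)+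
  have sorted: "L a b c = 24" if "a < b" "b < c" "c < 6" for a b c
  proof -
    have "a \<in> {0, 1, 2, 3}" "b \<in> {1, 2, 3, 4}" "c \<in> {2, 3, 4, 5}" using that by auto
    then show ?thesis
      unfolding L_def using that by (intro length_filter_copy_W10) (elim insertE emptyE; simp add: weight_W10_def)
  qed
  consider "a < b" "b < c" | "a < c" "c < b" | "b < a" "a < c" | "b < c" "c < a" | "c < a" "a < b" | "c < b" "b < a"
    using assms by (auto simp: neq_iff)
  then have "L a b c = 24"
    by cases (use assms sorted swap in metis)+
  then show ?thesis by (simp add: L_def)
qed

lemma Lambda_max_W10_ge:
  assumes m: "m = n div 6"
  shows "24 * 2 ^ n * (120 * (m * ((m - 1) * (m - 2)))) \<le> 48 * 32 * Lambda_max 3 W10 n"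
proof -
  let ?st = "xor_step weight_W10"
  define A :: "(nat \<times> nat \<times> nat) set" where "A = {(a, b, c). a < 6 \<and> b < 6 \<and> c < 6 \<and> distinct [a, b, c]}"
  have pat: "(\<lambda>x y z. code_W10 (step_if ?st x a (step_if ?st y b (step_if ?st z c s)))) =
      oct (code_W10 s) (code_W10 (xor s (weight_W10 c))) (code_W10 (xor s (weight_W10 b)))
        (code_W10 (xor (xor s (weight_W10 c)) (weight_W10 b))) (code_W10 (xor s (weight_W10 a)))
        (code_W10 (xor (xor s (weight_W10 c)) (weight_W10 a))) (code_W10 (xor (xor s (weight_W10 b)) (weight_W10 a)))
        (code_W10 (xor (xor (xor s (weight_W10 c)) (weight_W10 b)) (weight_W10 a)))" for a b c s
    by (simp add: fun_eq_iff oct_def step_if_def xor_step_def)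
  have "24 \<le> card {s \<in> {0..<2 ^ 5}. iso_pattern W10 (\<lambda>x y z. code_W10 (step_if ?st x a (step_if ?st y b (step_if ?st z c s))))}"
    if "(a, b, c) \<in> A" for a b c
  proof -
    let ?L = "filter (copy_W10 (weight_W10 a) (weight_W10 b) (weight_W10 c)) [0..31]"
    show ?thesis
    proof (rule card_ge_subset[of _ "set ?L"])
      show "24 \<le> card (set ?L)"
        using length_filter_weight_W10[of a b c] that by (subst distinct_card) (auto simp: A_def)
    qed (auto simp: pat copy_W10_def)
  qed
  moreover have "card A = 120" unfolding A_def by (subst card_distinct_triples) simp
  moreover have "A \<subseteq> {..<6} \<times> {..<6} \<times> {..<6}" by (auto simp: A_def)
  moreover have "bij_betw (?st i) {0..<2 ^ 5} {0..<2 ^ 5}" for i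
    by (rule bij_betw_xor_step) (simp_all add: weight_W10_def)
  ultimately show ?thesis
    using Lambda_max_ge_periodic[where \<sigma> = ?st and T = "{0..<2 ^ 5}" and A = A and M = 6 and r = 24 and F = code_W10
        and n = n and m = m, OF W_subset_cube(4) _ _ xor_step_commute] m
    by simp
qed

theorem theorem1p1:
  shows "ind_ratio 3 W7 \<longlonglongrightarrow> 1/3 \<and>
         ind_ratio 3 W8 \<longlonglongrightarrow> 2/3 \<and>
         ind_ratio 3 W9 \<longlonglongrightarrow> 4/9 \<and>
         ind_ratio 3 W10 \<longlonglongrightarrow> 5/12 \<and>
         ind_ratio 3 W12 \<longlonglongrightarrow> 1/2"
proof (intro conjI)
  show "ind_ratio 3 W7 \<longlonglongrightarrow> 1/3"
    by (rule ind_ratio_tendsto[where N = 18 and K = 6 and M = 1, OF _ Lambda_max_W7_ge]) (simp_all add: Lambda_set_W7_le[simplified])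
  show "ind_ratio 3 W8 \<longlonglongrightarrow> 2/3"
    by (rule ind_ratio_tendsto[where N = 3 and K = 2 and M = 1, OF _ Lambda_max_W8_ge]) (simp_all add: Lambda_set_W8_le[simplified])
  show "ind_ratio 3 W9 \<longlonglongrightarrow> 4/9"
    by (rule ind_ratio_tendsto[where N = 108 and K = 48 and M = 3, OF _ Lambda_max_W9_ge]) (simp_all add: Lambda_set_W9_le[simplified])
  show "ind_ratio 3 W10 \<longlonglongrightarrow> 5/12"
    by (rule ind_ratio_tendsto[where N = 2880 and K = 1200 and M = 6, OF _ Lambda_max_W10_ge]) (simp_all add: Lambda_set_W10_le[simplified])
  show "ind_ratio 3 W12 \<longlonglongrightarrow> 1/2"
    by (rule ind_ratio_tendsto[where N = 12 and K = 6 and M = 1, OF _ Lambda_max_W12_ge]) (simp_all add: Lambda_set_W12_le[simplified])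
qed

end
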